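(* Let $S=k[x_1,\ldots,x_n]$ ($k$ a field) and let $I\subset S$ be a square-free monomial ideal with distinct minimal monomial generators $\mathbf{m}_1,\ldots,\mathbf{m}_s,\mathbf{n}_1,\ldots,\mathbf{n}_k$, where $k\geq 1$, such that $\mathbf{m}_1,\ldots,\mathbf{m}_s$ is a well ordered cover of $I$. For each $1\leq i\leq k$ define $$\alpha_i=\max\{j : \mathbf{m}_j\mid\mathrm{lcm}(\mathbf{n}_i,\mathbf{m}_{j+1},\ldots,\mathbf{m}_s)\}.$$ If $\ell=\min(\alpha_1,\ldots,\alpha_k)>1$, then: 1. for every $i\in\{2,\ldots,\ell\}$ the sequence $$\mathbf{m}_i,\mathbf{m}_{i+1},\ldots,\mathbf{m}_s,\mathbf{m}_1,\ldots,\mathbf{m}_{i-1}$$ is a well ordered cover of $I$; 2. $t_s\leq t_{s-i}+t_i$ for $1\leq i\leq\ell-1$.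
   Context: "Generators" of a monomial ideal always means its minimal monomial generators. A set of generators of a square-free monomial ideal $I$ is a cover of $I$ if every variable dividing some generator of $I$ divides some element of the set; it is a minimal cover if no proper subset is a cover. A sequence $\mathbf{m}_1,\ldots,\mathbf{m}_s$ of (distinct) generators of $I$ is a well ordered cover of $I$ if $\{\mathbf{m}_1,\ldots,\mathbf{m}_s\}$ is a minimal cover of $I$ and for every generator $\mathbf{n}\notin\{\mathbf{m}_1,\ldots,\mathbf{m}_s\}$ of $I$ there is an index $1\leq j\leq s-1$ with $\mathbf{m}_j\mid\mathrm{lcm}(\mathbf{n},\mathbf{m}_{j+1},\ldots,\mathbf{m}_s)$. $\beta_{i,j}(S/I)$ denotes the graded Betti numbers of $S/I$ over $S$, and $t_i=\max\{j:\beta_{i,j}(S/I)\neq 0\}$. (The symbol $k$ is used both for the coefficient field and for the number of generators $\mathbf{n}_i$; these are unrelated.) *)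

theory Defs
  imports Complex_Main "HOL-Library.Poly_Mapping" "HOL-Library.Function_Algebras"
begin

text \<open>
  A monomial in the variables \<open>x\<^sub>v\<close>, \<open>v :: 'n\<close>, is represented by its exponent vector
  \<open>'n \<Rightarrow> nat\<close>, with the pointwise monoid and lattice structure.  For a finite type \<open>'n\<close>,
  divisibility is thus \<open>\<le>\<close>, the lcm is \<open>sup\<close>, the monomial 1 is \<open>0\<close>, and
  \<open>('n, 'k) poly_ring\<close> is the polynomial ring over \<open>'k\<close> in \<open>CARD('n)\<close> variables.
\<close>

type_synonym 'n monomial = "'n \<Rightarrow> nat"
type_synonym ('n, 'k) poly_ring = "'n monomial \<Rightarrow>\<^sub>0 'k"

definition mon :: "'n monomial \<Rightarrow> ('n, 'k::field) poly_ring" where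
  "mon t = Poly_Mapping.single t 1"

definition mdegree :: "'n::finite monomial \<Rightarrow> nat" where
  "mdegree t = (\<Sum>v\<in>UNIV. t v)"

definition lcm_list :: "'n monomial list \<Rightarrow> 'n monomial" where
  "lcm_list ts = foldr sup ts 0"

lemma module_times: "module ((*) :: 'a::comm_ring_1 \<Rightarrow> 'a \<Rightarrow> 'a)"
  by unfold_locales (simp_all add: algebra_simps)

abbreviation ideal_generated :: "'a::comm_ring_1 set \<Rightarrow> 'a set" where
  "ideal_generated \<equiv> module.span (*)"

definition squarefree_monomial_ideal :: "('n::finite, 'k::field) poly_ring set \<Rightarrow> bool" where
  "squarefree_monomial_ideal I \<longleftrightarrow>
     (\<exists>M. (\<forall>t\<in>M. \<forall>v. t v \<le> 1) \<and> I = ideal_generated (mon ` M))"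

text \<open>The minimal monomial generators: the monomials in \<open>I\<close> that are minimal for divisibility.\<close>

definition min_gens :: "('n::finite, 'k::field) poly_ring set \<Rightarrow> 'n monomial set" where
  "min_gens I = {t. mon t \<in> I \<and> (\<forall>u. mon u \<in> I \<longrightarrow> u \<le> t \<longrightarrow> u = t)}"

definition is_cover :: "('n::finite, 'k::field) poly_ring set \<Rightarrow> 'n monomial set \<Rightarrow> bool" where
  "is_cover I A \<longleftrightarrow> A \<subseteq> min_gens I \<and>
     (\<forall>v. (\<exists>g\<in>min_gens I. g v > 0) \<longrightarrow> (\<exists>a\<in>A. a v > 0))"

definition is_minimal_cover :: "('n::finite, 'k::field) poly_ring set \<Rightarrow> 'n monomial set \<Rightarrow> bool" where
  "is_minimal_cover I A \<longleftrightarrow> is_cover I A \<and> (\<forall>B. B \<subset> A \<longrightarrow> \<not> is_cover I B)"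

text \<open>
  \<open>divides_tail ms n j\<close> says that \<open>m\<^sub>j\<close> divides the lcm of \<open>n, m\<^sub>j\<^sub>+\<^sub>1, \<dots>, m\<^sub>s\<close>.  The index \<open>j\<close> is
  1-based, as in the mathematical text, so \<open>m\<^sub>j\<close> is \<open>ms ! (j - 1)\<close>.
\<close>

definition divides_tail :: "'n monomial list \<Rightarrow> 'n monomial \<Rightarrow> nat \<Rightarrow> bool" where
  "divides_tail ms n j \<longleftrightarrow> ms ! (j - 1) \<le> lcm_list (n # drop j ms)"

definition well_ordered_cover :: "('n::finite, 'k::field) poly_ring set \<Rightarrow> 'n monomial list \<Rightarrow> bool" where
  "well_ordered_cover I ms \<longleftrightarrow> distinct ms \<and> is_minimal_cover I (set ms) \<and>
     (\<forall>n \<in> min_gens I - set ms. \<exists>j \<in> {1..length ms - 1}. divides_tail ms n j)"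

definition alpha :: "'n monomial list \<Rightarrow> 'n monomial \<Rightarrow> nat" where
  "alpha ms n = Max {j \<in> {1..length ms}. divides_tail ms n j}"

text \<open>
  A complex \<open>\<cdots> \<rightarrow> F\<^sub>2 \<rightarrow> F\<^sub>1 \<rightarrow> F\<^sub>0\<close> of free modules with a map \<open>F\<^sub>0 \<rightarrow> S\<close>, given by matrices.
  The basis of \<open>F\<^sub>i\<close> is indexed by \<open>basis F i\<close>, and its element \<open>a\<close> has degree \<open>bdeg F i a\<close>,
  i.e. it spans a summand \<open>S(-bdeg F i a)\<close>.  The matrix \<open>bdry F i\<close> is that of the map
  \<open>F\<^sub>i\<^sub>+\<^sub>1 \<rightarrow> F\<^sub>i\<close> (row index first), and \<open>aug F a\<close> represents the image of \<open>a\<close> under \<open>F\<^sub>0 \<rightarrow> S/I\<close>.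
  Elements of \<open>F\<^sub>i\<close> are coefficient vectors \<open>nat \<Rightarrow> S\<close> vanishing outside \<open>basis F i\<close>.
  Natural numbers suffice as degrees because \<open>S/I\<close> lives in nonnegative degrees.
\<close>

record (overloaded) ('n, 'k) free_cplx =
  basis :: "nat \<Rightarrow> nat set"
  bdeg :: "nat \<Rightarrow> nat \<Rightarrow> nat"
  bdry :: "nat \<Rightarrow> nat \<Rightarrow> nat \<Rightarrow> ('n monomial \<Rightarrow>\<^sub>0 'k)"
  aug :: "nat \<Rightarrow> ('n monomial \<Rightarrow>\<^sub>0 'k)"

definition homogeneous :: "nat \<Rightarrow> nat \<Rightarrow> ('n::finite, 'k::field) poly_ring \<Rightarrow> bool" where
  "homogeneous d e p \<longleftrightarrow> (\<forall>t \<in> Poly_Mapping.keys p. mdegree t + d = e)"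

definition fmod :: "('n::finite, 'k::field) free_cplx \<Rightarrow> nat \<Rightarrow> (nat \<Rightarrow> ('n, 'k) poly_ring) set" where
  "fmod F i = {v. \<forall>a. a \<notin> basis F i \<longrightarrow> v a = 0}"

definition bmap :: "('n::finite, 'k::field) free_cplx \<Rightarrow> nat \<Rightarrow>
    (nat \<Rightarrow> ('n, 'k) poly_ring) \<Rightarrow> nat \<Rightarrow> ('n, 'k) poly_ring" where
  "bmap F i v = (\<lambda>a. if a \<in> basis F i then \<Sum>b\<in>basis F (Suc i). bdry F i a b * v b else 0)"

definition amap :: "('n::finite, 'k::field) free_cplx \<Rightarrow>
    (nat \<Rightarrow> ('n, 'k) poly_ring) \<Rightarrow> ('n, 'k) poly_ring" where
  "amap F v = (\<Sum>a\<in>basis F 0. aug F a * v a)"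

definition graded_free_resolution ::
    "('n::finite, 'k::field) poly_ring set \<Rightarrow> ('n, 'k) free_cplx \<Rightarrow> bool" where
  "graded_free_resolution I F \<longleftrightarrow>
     (\<forall>i. finite (basis F i)) \<and>
     (\<forall>a\<in>basis F 0. homogeneous 0 (bdeg F 0 a) (aug F a)) \<and>
     (\<forall>i. \<forall>a\<in>basis F i. \<forall>b\<in>basis F (Suc i).
        homogeneous (bdeg F i a) (bdeg F (Suc i) b) (bdry F i a b)) \<and>
     (\<forall>p. \<exists>v\<in>fmod F 0. p - amap F v \<in> I) \<and>
     bmap F 0 ` fmod F 1 = {v \<in> fmod F 0. amap F v \<in> I} \<and>
     (\<forall>i. bmap F (Suc i) ` fmod F (Suc (Suc i)) = {v \<in> fmod F (Suc i). bmap F i v = 0})"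

text \<open>Minimality: all matrix entries lie in the ideal generated by the variables, i.e. have zero
  constant coefficient.\<close>

definition minimal_graded_free_resolution ::
    "('n::finite, 'k::field) poly_ring set \<Rightarrow> ('n, 'k) free_cplx \<Rightarrow> bool" where
  "minimal_graded_free_resolution I F \<longleftrightarrow> graded_free_resolution I F \<and>
     (\<forall>i. \<forall>a\<in>basis F i. \<forall>b\<in>basis F (Suc i). Poly_Mapping.lookup (bdry F i a b) 0 = 0)"

text \<open>For a homogeneous ideal \<open>I\<close>, a minimal graded free resolution of \<open>S/I\<close> exists and is unique up
  to isomorphism, so the choice made here does not matter.\<close>

definition graded_betti :: "('n::finite, 'k::field) poly_ring set \<Rightarrow> nat \<Rightarrow> nat \<Rightarrow> nat" where
  "graded_betti I i j =
     (let F = SOME F. minimal_graded_free_resolution I F in card {a \<in> basis F i. bdeg F i a = j})"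

definition max_shift :: "('n::finite, 'k::field) poly_ring set \<Rightarrow> nat \<Rightarrow> nat" where
  "max_shift I i = Max {j. graded_betti I i j \<noteq> 0}"

end

theory Submission
  imports Defs "HOL-Library.Nat_Bijection"
begin

text \<open>
The first claim is a matter of divisibility. For a generator \<open>n\<close> outside the cover put \<open>j = \<alpha>(n)\<close>.
Minimality of generators excludes \<open>j = s\<close>, so \<open>\<ell> \<le> j < s\<close>. Rotating the cover by fewer than \<open>j\<close>
places keeps \<open>m\<^sub>j\<close> followed by all of \<open>m\<^sub>j\<^sub>+\<^sub>1, \<dots>, m\<^sub>s\<close>, so the divisibility that witnesses the
well ordering survives, and \<open>m\<^sub>j\<close> is still not in last position.

The second claim rests on a nonvanishing theorem for Betti numbers. Let \<open>x\<^sub>1, \<dots>, x\<^sub>r\<close> be generators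
of \<open>I\<close>, none dividing the lcm of the others, and suppose that every other generator \<open>n\<close> that divides
\<open>u = lcm(x\<^sub>1, \<dots>, x\<^sub>r)\<close> satisfies \<open>x\<^sub>j | lcm(n, x\<^sub>j\<^sub>+\<^sub>1, \<dots>, x\<^sub>r)\<close> for some \<open>j < r\<close>. Then the Betti number of
\<open>S/I\<close> in homological degree \<open>r\<close> and internal degree \<open>deg u\<close> is nonzero
(\<open>lcm_degree_occurs_in_every_resolution\<close>). This applies three times: to the whole cover
(so that \<open>t\<^sub>s\<close> is a maximum over a nonempty set), to
\<open>m\<^sub>i\<^sub>+\<^sub>1, \<dots>, m\<^sub>s\<close> (the indices \<open>\<alpha>(n) \<ge> \<ell> > i\<close> stay inside this tail), and to \<open>m\<^sub>1, \<dots>, m\<^sub>i\<close>. In the last case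
no other generator \<open>n\<close> divides \<open>u = lcm(m\<^sub>1, \<dots>, m\<^sub>i)\<close> at all: otherwise \<open>m\<^sub>j\<close> with \<open>j = \<alpha>(n) > i\<close> would divide
the lcm of the remaining members of the cover. Hence \<open>t\<^sub>i\<close> and \<open>t\<^sub>s\<^sub>-\<^sub>i\<close> are at least the degrees of
\<open>lcm(m\<^sub>1, \<dots>, m\<^sub>i)\<close> and \<open>lcm(m\<^sub>i\<^sub>+\<^sub>1, \<dots>, m\<^sub>s)\<close>. Every basis degree of a minimal resolution is at most
the degree of the lcm of all generators. That lcm is square-free, and the cover involves all its
variables, so it divides the product of these two.

The nonvanishing theorem is read off from the Lyubeznik resolution, the subcomplex of the Taylor
complex spanned by the sets of generators in which no earlier generator divides the lcm of a tail.
Its strand in each multidegree is a cone, whose apex is the first generator that divides the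
multidegree; this gives exactness. When the \<open>x\<^sub>j\<close> come first in the order of the generators, they span
a cell. Deleting one of them lowers the lcm, and by the hypothesis on the other generators no cell with
the same lcm properly contains this one. So neither its column nor its row has a unit entry.

Two facts relate this resolution to the minimal one in the definition of the Betti numbers. Any two
graded free resolutions of \<open>S/I\<close> are homotopy equivalent, so a basis element whose row and column have
no unit entry forces a basis element of the same degree in every other resolution
(\<open>degree_occurs_in_every_resolution\<close>). And a finite graded free resolution becomes minimal by
cancelling unit entries one at a time (\<open>minimal_resolution_exists\<close>).
\<close>

section \<open>Homogeneous parts of polynomials\<close>

lemma lookup_mult_0_left:
  fixes p q :: "('n::finite, 'k::field) poly_ring"
  assumes "Poly_Mapping.lookup p 0 = 0"
  shows "Poly_Mapping.lookup (p * q) 0 = 0"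
proof (rule ccontr)
  assume "Poly_Mapping.lookup (p * q) 0 \<noteq> 0"
  then have "0 \<in> Poly_Mapping.keys (p * q)"
    by (simp add: in_keys_iff)
  then obtain a b where "0 = a + b" "a \<in> Poly_Mapping.keys p"
    using keys_mult[of p q] by blast
  moreover from this have "a = 0"
    by (auto simp: fun_eq_iff)
  ultimately show False
    using assms by (simp add: in_keys_iff)
qed

text \<open>
The part of \<open>p\<close> that has degree \<open>e\<close> when \<open>p\<close> is read as the coefficient of a basis element of degree \<open>d\<close>.
\<close>

definition hpart :: "nat \<Rightarrow> nat \<Rightarrow> ('n::finite, 'k::field) poly_ring \<Rightarrow> ('n, 'k) poly_ring" where
  "hpart d e p = Poly_Mapping.Abs_poly_mapping
     (\<lambda>t. if mdegree t + d = e then Poly_Mapping.lookup p t else 0)"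

lemma lookup_hpart:
  "Poly_Mapping.lookup (hpart d e p) t = (if mdegree t + d = e then Poly_Mapping.lookup p t else 0)"
proof -
  have "finite {t. (if mdegree t + d = e then Poly_Mapping.lookup p t else 0) \<noteq> 0}"
    by (rule finite_subset[OF _ finite_lookup[of p]]) auto
  then show ?thesis
    unfolding hpart_def by (subst lookup_Abs_poly_mapping) auto
qed

lemma hpart_add: "hpart d e (p + q) = hpart d e p + hpart d e q"
  by (rule poly_mapping_eqI) (simp add: lookup_hpart lookup_add)

lemma hpart_0: "hpart d e 0 = 0"
  by (rule poly_mapping_eqI) (simp add: lookup_hpart)

lemma hpart_sum: "hpart d e (\<Sum>x\<in>A. f x) = (\<Sum>x\<in>A. hpart d e (f x))"
  by (induction A rule: infinite_finite_induct) (simp_all add: hpart_add hpart_0)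

lemma homogeneous_hpart: "homogeneous d e (hpart d e p)"
  by (auto simp: homogeneous_def in_keys_iff lookup_hpart split: if_splits)

lemma hpart_homogeneous: "homogeneous d e p \<Longrightarrow> hpart d e p = p"
  by (rule poly_mapping_eqI) (auto simp: lookup_hpart homogeneous_def in_keys_iff)

lemma hpart_eq_0I: "(\<And>t. t \<in> Poly_Mapping.keys p \<Longrightarrow> mdegree t + d \<noteq> e) \<Longrightarrow> hpart d e p = 0"
  by (rule poly_mapping_eqI) (auto simp: lookup_hpart in_keys_iff)

lemma mdegree_add: "mdegree (s + t) = mdegree s + mdegree t"
  by (simp add: mdegree_def sum.distrib)

lemma homogeneous_mult:
  assumes "homogeneous a b p" and "homogeneous b c q"
  shows "homogeneous a c (p * q)"
  unfolding homogeneous_def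
proof
  fix t assume "t \<in> Poly_Mapping.keys (p * q)"
  then obtain u v where "t = u + v" "u \<in> Poly_Mapping.keys p" "v \<in> Poly_Mapping.keys q"
    using keys_mult[of p q] by blast
  with assms show "mdegree t + a = c"
    by (auto simp: homogeneous_def mdegree_add)
qed

lemma homogeneous_add: "homogeneous a b p \<Longrightarrow> homogeneous a b q \<Longrightarrow> homogeneous a b (p + q)"
  using keys_add[of p q] by (auto simp: homogeneous_def)

lemma homogeneous_uminus: "homogeneous a b p \<Longrightarrow> homogeneous a b (- p)"
  by (simp add: homogeneous_def in_keys_iff)

lemma homogeneous_diff: "homogeneous a b p \<Longrightarrow> homogeneous a b q \<Longrightarrow> homogeneous a b (p - q)"
  using homogeneous_add[of a b p "- q"] homogeneous_uminus by auto

lemma homogeneous_0 [simp]: "homogeneous a b 0"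
  by (simp add: homogeneous_def)

lemma homogeneous_sum: "(\<And>x. x \<in> A \<Longrightarrow> homogeneous a b (f x)) \<Longrightarrow> homogeneous a b (\<Sum>x\<in>A. f x)"
  by (induction A rule: infinite_finite_induct) (simp_all add: homogeneous_add)

text \<open>
A homogeneous entry from degree \<open>b\<close> to degree \<open>a\<close> shifts degrees by \<open>b - a\<close>, so the remainder
\<open>q - hpart b e q\<close> contributes nothing in degree \<open>e\<close>. Hence homogeneous matrices commute with taking
homogeneous parts of vectors.
\<close>

lemma hpart_mult:
  fixes p q :: "('n::finite, 'k::field) poly_ring"
  assumes "homogeneous a b p"
  shows "hpart a e (p * q) = p * hpart b e q"
proof -
  have "hpart a e (p * (q - hpart b e q)) = 0"
  proof (rule hpart_eq_0I)
    fix t assume "t \<in> Poly_Mapping.keys (p * (q - hpart b e q))"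
    then obtain u v where t: "t = u + v" "u \<in> Poly_Mapping.keys p"
      and v: "v \<in> Poly_Mapping.keys (q - hpart b e q)"
      using keys_mult by blast
    from v have "mdegree v + b \<noteq> e"
      by (auto simp: in_keys_iff lookup_minus lookup_hpart)
    moreover have "mdegree u + a = b"
      using t assms by (auto simp: homogeneous_def)
    ultimately show "mdegree t + a \<noteq> e"
      by (simp add: t mdegree_add)
  qed
  moreover have "hpart a e (p * hpart b e q) = p * hpart b e q"
    by (intro hpart_homogeneous homogeneous_mult[OF assms] homogeneous_hpart)
  moreover have "p * q = p * (q - hpart b e q) + p * hpart b e q"
    by (simp add: algebra_simps)
  ultimately show ?thesis
    by (simp add: hpart_add)
qed

section \<open>Vectors over the polynomial ring\<close>

type_synonym ('n, 'k) vec = "nat \<Rightarrow> ('n, 'k) poly_ring"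

definition smul :: "('n::finite, 'k::field) poly_ring \<Rightarrow> ('n, 'k) vec \<Rightarrow> ('n, 'k) vec" where
  "smul c v = (\<lambda>a. c * v a)"

definition unit_vec :: "nat \<Rightarrow> ('n::finite, 'k::field) vec" where
  "unit_vec a = (\<lambda>b. if b = a then 1 else 0)"

definition homogeneous_vec :: "('n::finite, 'k::field) free_cplx \<Rightarrow> nat \<Rightarrow> nat \<Rightarrow> ('n, 'k) vec \<Rightarrow> bool" where
  "homogeneous_vec F i e v \<longleftrightarrow> v \<in> fmod F i \<and> (\<forall>a\<in>basis F i. homogeneous (bdeg F i a) e (v a))"

text \<open>
The vectors that vanish when all variables are set to 0, so that only the residue field is left.
\<close>

definition no_const :: "('n::finite, 'k::field) vec \<Rightarrow> bool" where
  "no_const v \<longleftrightarrow> (\<forall>a. Poly_Mapping.lookup (v a) 0 = 0)"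

lemma sum_fun_apply: "(\<Sum>x\<in>A. f x) a = (\<Sum>x\<in>A. f x a)"
  by (induction A rule: infinite_finite_induct) simp_all

lemma fmod_0 [simp]: "0 \<in> fmod F i"
  by (simp add: fmod_def)

lemma fmod_add [simp]: "u \<in> fmod F i \<Longrightarrow> v \<in> fmod F i \<Longrightarrow> u + v \<in> fmod F i"
  by (simp add: fmod_def)

lemma fmod_diff [simp]: "u \<in> fmod F i \<Longrightarrow> v \<in> fmod F i \<Longrightarrow> u - v \<in> fmod F i"
  by (simp add: fmod_def)

lemma fmod_smul [simp]: "v \<in> fmod F i \<Longrightarrow> smul c v \<in> fmod F i"
  by (simp add: fmod_def smul_def)

lemma fmod_sum: "(\<And>x. x \<in> A \<Longrightarrow> f x \<in> fmod F i) \<Longrightarrow> (\<Sum>x\<in>A. f x) \<in> fmod F i"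
  by (induction A rule: infinite_finite_induct) auto

lemma fmod_unit_vec [simp]: "a \<in> basis F i \<Longrightarrow> unit_vec a \<in> fmod F i"
  by (auto simp: fmod_def unit_vec_def)

lemma fmod_bmap [simp]: "bmap F i v \<in> fmod F i"
  by (simp add: fmod_def bmap_def)

lemma bmap_add: "bmap F i (u + v) = bmap F i u + bmap F i v"
  by (auto simp: bmap_def fun_eq_iff distrib_left sum.distrib)

lemma bmap_0 [simp]: "bmap F i 0 = 0"
  by (auto simp: bmap_def fun_eq_iff)

lemma bmap_diff: "bmap F i (u - v) = bmap F i u - bmap F i v"
  by (auto simp: bmap_def fun_eq_iff right_diff_distrib sum_subtractf)

lemma bmap_smul: "bmap F i (smul c v) = smul c (bmap F i v)"
  by (auto simp: bmap_def smul_def fun_eq_iff sum_distrib_left mult.left_commute)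

lemma bmap_unit_vec:
  assumes "finite (basis F (Suc i))" and "b \<in> basis F (Suc i)"
  shows "bmap F i (unit_vec b) = (\<lambda>a. if a \<in> basis F i then bdry F i a b else 0)"
proof (rule ext)
  fix a
  have "(\<Sum>b'\<in>basis F (Suc i). bdry F i a b' * unit_vec b b')
      = (\<Sum>b'\<in>basis F (Suc i). if b' = b then bdry F i a b else 0)"
    by (rule sum.cong) (auto simp: unit_vec_def)
  then show "bmap F i (unit_vec b) a = (if a \<in> basis F i then bdry F i a b else 0)"
    using assms by (simp add: bmap_def)
qed

lemma amap_diff: "amap F (u - v) = amap F u - amap F v"
  by (simp add: amap_def right_diff_distrib sum_subtractf)

lemma amap_smul: "amap F (smul c v) = c * amap F v"
  by (simp add: amap_def smul_def sum_distrib_left mult.left_commute)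

lemma vec_expansion:
  assumes "finite (basis F i)" and "v \<in> fmod F i"
  shows "v = (\<Sum>a\<in>basis F i. smul (v a) (unit_vec a))"
proof (rule ext)
  fix b
  have "(\<Sum>a\<in>basis F i. smul (v a) (unit_vec a)) b = (\<Sum>a\<in>basis F i. if a = b then v a else 0)"
    unfolding sum_fun_apply by (rule sum.cong) (auto simp: smul_def unit_vec_def)
  also have "\<dots> = v b"
    using assms by (auto simp: fmod_def)
  finally show "v b = (\<Sum>a\<in>basis F i. smul (v a) (unit_vec a)) b" ..
qed

lemma homogeneous_vec_unit_vec: "a \<in> basis F i \<Longrightarrow> homogeneous_vec F i (bdeg F i a) (unit_vec a)"
  by (auto simp: homogeneous_vec_def fmod_def unit_vec_def homogeneous_def mdegree_def)

definition vpart :: "('n::finite, 'k::field) free_cplx \<Rightarrow> nat \<Rightarrow> nat \<Rightarrow> ('n, 'k) vec \<Rightarrow> ('n, 'k) vec" where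
  "vpart F i e v = (\<lambda>a. hpart (bdeg F i a) e (v a))"

lemma homogeneous_vec_vpart: "v \<in> fmod F i \<Longrightarrow> homogeneous_vec F i e (vpart F i e v)"
  by (auto simp: homogeneous_vec_def vpart_def fmod_def homogeneous_hpart hpart_0)

lemma vpart_homogeneous_vec: "homogeneous_vec F i e v \<Longrightarrow> vpart F i e v = v"
  unfolding vpart_def homogeneous_vec_def fmod_def
  by (rule ext) (metis (mono_tags, lifting) hpart_0 hpart_homogeneous mem_Collect_eq)

text \<open>
Containing the homogeneous parts of its members is what lets graded maps be lifted along the
augmentation.
\<close>

definition homogeneous_ideal :: "('n::finite, 'k::field) poly_ring set \<Rightarrow> bool" where
  "homogeneous_ideal I \<longleftrightarrow> module.subspace (*) I \<and> (\<forall>p\<in>I. \<forall>e. hpart 0 e p \<in> I)"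

text \<open>
Treating the augmentation to \<open>S/I\<close> as the boundary in position \<open>0\<close> makes exactness the same statement
in every position.
\<close>

definition cycle :: "('n::finite, 'k::field) poly_ring set \<Rightarrow> ('n, 'k) free_cplx \<Rightarrow> nat \<Rightarrow> ('n, 'k) vec \<Rightarrow> bool" where
  "cycle I F i v \<longleftrightarrow> v \<in> fmod F i \<and> (case i of 0 \<Rightarrow> amap F v \<in> I | Suc j \<Rightarrow> bmap F j v = 0)"

lemma cycle_0: "cycle I F 0 v \<longleftrightarrow> v \<in> fmod F 0 \<and> amap F v \<in> I"
  and cycle_Suc: "cycle I F (Suc i) v \<longleftrightarrow> v \<in> fmod F (Suc i) \<and> bmap F i v = 0"
  by (simp_all add: cycle_def)

lemma resolution_finite: "graded_free_resolution I F \<Longrightarrow> finite (basis F i)"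
  by (simp add: graded_free_resolution_def)

lemma resolution_bdry:
  "graded_free_resolution I F \<Longrightarrow> a \<in> basis F i \<Longrightarrow> b \<in> basis F (Suc i) \<Longrightarrow>
     homogeneous (bdeg F i a) (bdeg F (Suc i) b) (bdry F i a b)"
  by (simp add: graded_free_resolution_def)

lemma resolution_aug:
  "graded_free_resolution I F \<Longrightarrow> a \<in> basis F 0 \<Longrightarrow> homogeneous 0 (bdeg F 0 a) (aug F a)"
  by (simp add: graded_free_resolution_def)

lemma resolution_surj:
  "graded_free_resolution I F \<Longrightarrow> \<exists>v\<in>fmod F 0. p - amap F v \<in> I"
  by (simp add: graded_free_resolution_def)

lemma resolution_exact:
  assumes "graded_free_resolution I F"
  shows "cycle I F i v \<longleftrightarrow> v \<in> bmap F i ` fmod F (Suc i)"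
proof (cases i)
  case 0
  from assms have "bmap F 0 ` fmod F 1 = {v \<in> fmod F 0. amap F v \<in> I}"
    by (simp add: graded_free_resolution_def)
  then show ?thesis
    by (simp add: 0 cycle_0)
next
  case (Suc j)
  from assms have "bmap F (Suc j) ` fmod F (Suc (Suc j)) = {v \<in> fmod F (Suc j). bmap F j v = 0}"
    by (simp add: graded_free_resolution_def)
  then show ?thesis
    by (simp add: Suc cycle_Suc)
qed

lemma cycle_bmap:
  "graded_free_resolution I F \<Longrightarrow> v \<in> fmod F (Suc i) \<Longrightarrow> cycle I F i (bmap F i v)"
  by (simp add: resolution_exact)

lemma bmap_vpart:
  assumes "graded_free_resolution I F"
  shows "bmap F i (vpart F (Suc i) e w) = vpart F i e (bmap F i w)"
proof (rule ext)
  fix a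
  show "bmap F i (vpart F (Suc i) e w) a = vpart F i e (bmap F i w) a"
  proof (cases "a \<in> basis F i")
    case True
    then show ?thesis
      by (auto simp: bmap_def vpart_def hpart_sum hpart_mult[OF resolution_bdry[OF assms True]]
          intro!: sum.cong)
  qed (simp add: bmap_def vpart_def hpart_0)
qed

lemma homogeneous_vec_bmap:
  assumes "graded_free_resolution I F" "homogeneous_vec F (Suc i) e w"
  shows "homogeneous_vec F i e (bmap F i w)"
  using homogeneous_vec_vpart[OF fmod_bmap, of F i e w] bmap_vpart[OF assms(1), of i e w]
    vpart_homogeneous_vec[OF assms(2)] by simp

lemma amap_vpart:
  assumes "graded_free_resolution I F"
  shows "amap F (vpart F 0 e w) = hpart 0 e (amap F w)"
  by (auto simp: amap_def vpart_def hpart_sum hpart_mult[OF resolution_aug[OF assms]]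
      intro!: sum.cong)

text \<open>
The degree \<open>e\<close> part of any preimage is again a preimage, because the boundary preserves degrees.
\<close>

lemma homogeneous_cycle_lift:
  assumes "graded_free_resolution I F" "cycle I F i v" "homogeneous_vec F i e v"
  obtains w where "homogeneous_vec F (Suc i) e w" "bmap F i w = v"
proof -
  from assms(1,2) obtain w where w: "w \<in> fmod F (Suc i)" "v = bmap F i w"
    by (auto simp: resolution_exact)
  show ?thesis
  proof
    show "homogeneous_vec F (Suc i) e (vpart F (Suc i) e w)"
      using w(1) by (rule homogeneous_vec_vpart)
    show "bmap F i (vpart F (Suc i) e w) = v"
      using bmap_vpart[OF assms(1)] w(2) vpart_homogeneous_vec[OF assms(3)] by metis
  qed
qed

section \<open>Comparison of resolutions up to homotopy\<close>

definition graded_linear ::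
    "('n::finite, 'k::field) free_cplx \<Rightarrow> nat \<Rightarrow> ('n, 'k) free_cplx \<Rightarrow> nat \<Rightarrow> (('n, 'k) vec \<Rightarrow> ('n, 'k) vec) \<Rightarrow> bool" where
  "graded_linear F i G j \<phi> \<longleftrightarrow>
     (\<forall>u v. \<phi> (u + v) = \<phi> u + \<phi> v) \<and> (\<forall>c v. \<phi> (smul c v) = smul c (\<phi> v)) \<and>
     (\<forall>e v. homogeneous_vec F i e v \<longrightarrow> homogeneous_vec G j e (\<phi> v))"

lemma graded_linear_0: 
  assumes "graded_linear F i G j \<phi>" shows "\<phi> 0 = 0"
proof -
  have "\<phi> (0 + 0) = \<phi> 0 + \<phi> 0"
    using assms unfolding graded_linear_def by blast
  then show ?thesis by simp
qed

lemma graded_linear_sum: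
  assumes "graded_linear F i G j \<phi>"
  shows "\<phi> (\<Sum>x\<in>A. f x) = (\<Sum>x\<in>A. \<phi> (f x))"
proof (induction A rule: infinite_finite_induct)
  case (insert x A)
  have "\<phi> (f x + (\<Sum>x\<in>A. f x)) = \<phi> (f x) + \<phi> (\<Sum>x\<in>A. f x)"
    using assms unfolding graded_linear_def by blast
  then show ?case
    unfolding sum.insert[OF insert(1,2)] insert(3) .
qed (simp_all only: sum.infinite sum.empty not_False_eq_True graded_linear_0[OF assms])

lemma graded_linear_expansion:
  assumes "graded_linear F i G j \<phi>" "finite (basis F i)" "v \<in> fmod F i"
  shows "\<phi> v = (\<Sum>a\<in>basis F i. smul (v a) (\<phi> (unit_vec a)))"
proof -
  have "\<phi> v = \<phi> (\<Sum>a\<in>basis F i. smul (v a) (unit_vec a))"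
    using vec_expansion[OF assms(2,3)] by simp
  also have "\<dots> = (\<Sum>a\<in>basis F i. \<phi> (smul (v a) (unit_vec a)))"
    by (rule graded_linear_sum[OF assms(1)])
  also have "\<dots> = (\<Sum>a\<in>basis F i. smul (v a) (\<phi> (unit_vec a)))"
    using assms(1) by (simp add: graded_linear_def)
  finally show ?thesis .
qed

lemma graded_linear_hom:
  "graded_linear F i G j \<phi> \<Longrightarrow> homogeneous_vec F i e v \<Longrightarrow> homogeneous_vec G j e (\<phi> v)"
  by (simp add: graded_linear_def)

lemma graded_linear_fmod:
  assumes "graded_linear F i G j \<phi>" "finite (basis F i)" "v \<in> fmod F i"
  shows "\<phi> v \<in> fmod G j"
proof -
  have "\<phi> (unit_vec a) \<in> fmod G j" if "a \<in> basis F i" for a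
    using graded_linear_hom[OF assms(1) homogeneous_vec_unit_vec[OF that]]
    by (simp add: homogeneous_vec_def)
  then show ?thesis
    unfolding graded_linear_expansion[OF assms] by (intro fmod_sum fmod_smul) auto
qed

lemma no_const_graded_linear:
  assumes "graded_linear F i G j \<phi>" "finite (basis F i)" "v \<in> fmod F i" "no_const v"
  shows "no_const (\<phi> v)"
  unfolding no_const_def graded_linear_expansion[OF assms(1-3)]
  using assms(4) by (auto simp: no_const_def sum_fun_apply lookup_sum smul_def lookup_mult_0_left)

lemma homogeneous_vec_diff:
  "homogeneous_vec F i e u \<Longrightarrow> homogeneous_vec F i e v \<Longrightarrow> homogeneous_vec F i e (u - v)"
  by (auto simp: homogeneous_vec_def homogeneous_diff)

lemma graded_linear_compose:
  "graded_linear F i G j \<phi> \<Longrightarrow> graded_linear G j H l \<psi> \<Longrightarrow> graded_linear F i H l (\<lambda>v. \<psi> (\<phi> v))"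
  by (simp add: graded_linear_def)

lemma graded_linear_id: "graded_linear F i F i (\<lambda>v. v)"
  by (simp add: graded_linear_def)

lemma graded_linear_minus:
  "graded_linear F i G j \<phi> \<Longrightarrow> graded_linear F i G j \<psi> \<Longrightarrow> graded_linear F i G j (\<lambda>v. \<phi> v - \<psi> v)"
  by (simp add: graded_linear_def homogeneous_vec_diff smul_def fun_eq_iff algebra_simps)

lemma graded_linear_bmap:
  "graded_free_resolution I F \<Longrightarrow> graded_linear F (Suc i) F i (bmap F i)"
  by (simp add: graded_linear_def bmap_add bmap_smul homogeneous_vec_bmap)

lemma homogeneous_vec_smul_sum:
  assumes "\<And>a. a \<in> A \<Longrightarrow> homogeneous (d a) e (c a)" "\<And>a. a \<in> A \<Longrightarrow> homogeneous_vec G j (d a) (y a)"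
  shows "homogeneous_vec G j e (\<Sum>a\<in>A. smul (c a) (y a))"
  unfolding homogeneous_vec_def
proof
  show "(\<Sum>a\<in>A. smul (c a) (y a)) \<in> fmod G j"
    using assms by (intro fmod_sum fmod_smul) (auto simp: homogeneous_vec_def)
  show "\<forall>b\<in>basis G j. homogeneous (bdeg G j b) e ((\<Sum>a\<in>A. smul (c a) (y a)) b)"
  proof
    fix b assume b: "b \<in> basis G j"
    have "homogeneous (bdeg G j b) e (y a b * c a)" if "a \<in> A" for a
      using assms(2)[OF that] b by (intro homogeneous_mult[OF _ assms(1)[OF that]]) (auto simp: homogeneous_vec_def)
    then show "homogeneous (bdeg G j b) e ((\<Sum>a\<in>A. smul (c a) (y a)) b)"
      unfolding sum_fun_apply smul_def by (intro homogeneous_sum) (simp add: mult.commute)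
  qed
qed

text \<open>
A graded linear map out of a free module can be prescribed on the basis.
\<close>

lemma graded_linear_extension:
  fixes F G :: "('n::finite, 'k::field) free_cplx"
  assumes "finite (basis F i)" "\<And>a. a \<in> basis F i \<Longrightarrow> homogeneous_vec G j (bdeg F i a) (y a)"
  obtains \<phi> where "graded_linear F i G j \<phi>" "\<And>a. a \<in> basis F i \<Longrightarrow> \<phi> (unit_vec a) = y a"
proof
  let ?\<phi> = "\<lambda>v. \<Sum>a\<in>basis F i. smul (v a) (y a)"
  show "graded_linear F i G j ?\<phi>"
    unfolding graded_linear_def
  proof (intro conjI allI impI)
    fix u v :: "('n, 'k) vec"
    show "?\<phi> (u + v) = ?\<phi> u + ?\<phi> v"
      by (auto simp: sum_fun_apply smul_def fun_eq_iff distrib_right sum.distrib)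
  next
    fix c and v :: "('n, 'k) vec"
    show "?\<phi> (smul c v) = smul c (?\<phi> v)"
      by (auto simp: sum_fun_apply smul_def fun_eq_iff sum_distrib_left mult.assoc)
  next
    fix e v assume "homogeneous_vec F i e v"
    then show "homogeneous_vec G j e (?\<phi> v)"
      by (intro homogeneous_vec_smul_sum[where d = "bdeg F i"] assms(2)) (auto simp: homogeneous_vec_def)
  qed
  show "?\<phi> (unit_vec a) = y a" if "a \<in> basis F i" for a
  proof (rule ext)
    fix b
    have "?\<phi> (unit_vec a) b = (\<Sum>x\<in>basis F i. if x = a then y x b else 0)"
      unfolding sum_fun_apply by (rule sum.cong) (auto simp: unit_vec_def smul_def)
    then show "?\<phi> (unit_vec a) b = y a b"
      using assms(1) that by simp
  qed
qed

text \<open>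
Free modules are projective: lifts are chosen on the basis and extended linearly.
\<close>

lemma graded_linear_lift:
  fixes F G :: "('n::finite, 'k::field) free_cplx"
  assumes G: "graded_free_resolution I G" and fin: "finite (basis F i)"
    and \<phi>: "graded_linear F i G j \<phi>" "\<And>v. v \<in> fmod F i \<Longrightarrow> cycle I G j (\<phi> v)"
  obtains \<psi> where "graded_linear F i G (Suc j) \<psi>" "\<And>v. v \<in> fmod F i \<Longrightarrow> bmap G j (\<psi> v) = \<phi> v"
proof -
  have "\<exists>w. homogeneous_vec G (Suc j) (bdeg F i a) w \<and> bmap G j w = \<phi> (unit_vec a)"
    if "a \<in> basis F i" for a
    using homogeneous_cycle_lift[OF G \<phi>(2)] graded_linear_hom[OF \<phi>(1)]
      homogeneous_vec_unit_vec[OF that] fmod_unit_vec[OF that] by metis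
  then obtain y where y: "\<And>a. a \<in> basis F i \<Longrightarrow> homogeneous_vec G (Suc j) (bdeg F i a) (y a)"
    "\<And>a. a \<in> basis F i \<Longrightarrow> bmap G j (y a) = \<phi> (unit_vec a)"
    by metis
  obtain \<psi> where \<psi>: "graded_linear F i G (Suc j) \<psi>" "\<And>a. a \<in> basis F i \<Longrightarrow> \<psi> (unit_vec a) = y a"
    using graded_linear_extension[OF fin y(1)] by blast
  show ?thesis
  proof
    show "graded_linear F i G (Suc j) \<psi>" by fact
    fix v assume v: "v \<in> fmod F i"
    show "bmap G j (\<psi> v) = \<phi> v"
      using graded_linear_expansion[OF graded_linear_compose[OF \<psi>(1) graded_linear_bmap[OF G]] fin v]
        graded_linear_expansion[OF \<phi>(1) fin v] \<psi>(2) y(2) by simp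
  qed
qed

lemma subspace_add: "module.subspace (*) I \<Longrightarrow> p \<in> I \<Longrightarrow> q \<in> I \<Longrightarrow> p + q \<in> I" for I :: "'a::comm_ring_1 set"
  using module.subspace_add[OF module_times] .

lemma subspace_diff: "module.subspace (*) I \<Longrightarrow> p \<in> I \<Longrightarrow> q \<in> I \<Longrightarrow> p - q \<in> I" for I :: "'a::comm_ring_1 set"
  using module.subspace_diff[OF module_times] .

lemma subspace_mult: "module.subspace (*) I \<Longrightarrow> p \<in> I \<Longrightarrow> c * p \<in> I" for I :: "'a::comm_ring_1 set"
  using module.subspace_scale[OF module_times] .

lemma subspace_sum: "module.subspace (*) I \<Longrightarrow> (\<And>x. x \<in> A \<Longrightarrow> f x \<in> I) \<Longrightarrow> (\<Sum>x\<in>A. f x) \<in> I" for I :: "'a::comm_ring_1 set"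
  using module.subspace_sum[OF module_times] .

text \<open>
The augmentation of \<open>G\<close> is onto modulo \<open>I\<close>, so each \<open>aug F a\<close> has a preimage there, and its part of
degree \<open>bdeg F 0 a\<close> is a preimage too since \<open>I\<close> is homogeneous.
\<close>

lemma comparison_map_0:
  fixes F G :: "('n::finite, 'k::field) free_cplx"
  assumes I: "homogeneous_ideal I" and F: "graded_free_resolution I F" and G: "graded_free_resolution I G"
  obtains f where "graded_linear F 0 G 0 f" "\<And>v. v \<in> fmod F 0 \<Longrightarrow> amap F v - amap G (f v) \<in> I"
proof -
  have sub: "module.subspace (*) I" using I by (simp add: homogeneous_ideal_def)
  have fin: "finite (basis F 0)" using resolution_finite[OF F] .
  have "\<exists>y. homogeneous_vec G 0 (bdeg F 0 a) y \<and> aug F a - amap G y \<in> I" if a: "a \<in> basis F 0" for a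
  proof -
    obtain y where y: "y \<in> fmod G 0" "aug F a - amap G y \<in> I"
      using resolution_surj[OF G] by blast
    let ?e = "bdeg F 0 a"
    have "hpart 0 ?e (aug F a - amap G y) \<in> I"
      using I y by (simp add: homogeneous_ideal_def)
    also have "hpart 0 ?e (aug F a - amap G y) = hpart 0 ?e (aug F a) - hpart 0 ?e (amap G y)"
      by (rule poly_mapping_eqI) (simp add: lookup_hpart lookup_minus)
    also have "hpart 0 ?e (aug F a) = aug F a"
      by (intro hpart_homogeneous resolution_aug[OF F a])
    also have "hpart 0 ?e (amap G y) = amap G (vpart G 0 ?e y)"
      by (simp add: amap_vpart[OF G])
    finally show ?thesis
      using homogeneous_vec_vpart[OF y(1)] by blast
  qed
  then obtain y where y: "\<And>a. a \<in> basis F 0 \<Longrightarrow> homogeneous_vec G 0 (bdeg F 0 a) (y a)"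
    "\<And>a. a \<in> basis F 0 \<Longrightarrow> aug F a - amap G (y a) \<in> I"
    by metis
  obtain f where f: "graded_linear F 0 G 0 f" "\<And>a. a \<in> basis F 0 \<Longrightarrow> f (unit_vec a) = y a"
    using graded_linear_extension[OF fin y(1)] by blast
  show ?thesis
  proof
    show "graded_linear F 0 G 0 f" by fact
    fix v assume v: "v \<in> fmod F 0"
    have amap_sum: "amap G (\<Sum>x\<in>A. g x) = (\<Sum>x\<in>A. amap G (g x))" for A :: "nat set" and g
      unfolding amap_def by (simp add: sum_fun_apply sum_distrib_left sum.swap[of _ A])
    have "amap G (f v) = (\<Sum>a\<in>basis F 0. v a * amap G (y a))"
      unfolding graded_linear_expansion[OF f(1) fin v] amap_sum by (simp add: amap_smul f(2))
    then have "amap F v - amap G (f v) = (\<Sum>a\<in>basis F 0. v a * (aug F a - amap G (y a)))"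
      by (simp add: amap_def right_diff_distrib sum_subtractf mult.commute)
    also have "\<dots> \<in> I"
      by (intro subspace_sum[OF sub] subspace_mult[OF sub] y(2))
    finally show "amap F v - amap G (f v) \<in> I" .
  qed
qed

text \<open>
The composite of \<open>f\<close> with the boundary of \<open>F\<close> has values in the cycles of \<open>G\<close>, and these are boundaries.
\<close>

lemma comparison_map_Suc:
  assumes F: "graded_free_resolution I F" and G: "graded_free_resolution I G"
    and f: "graded_linear F i G i f" "\<And>v. cycle I F i v \<Longrightarrow> cycle I G i (f v)"
  obtains f' where "graded_linear F (Suc i) G (Suc i) f'"
    "\<And>v. v \<in> fmod F (Suc i) \<Longrightarrow> bmap G i (f' v) = f (bmap F i v)"
    "\<And>v. cycle I F (Suc i) v \<Longrightarrow> cycle I G (Suc i) (f' v)"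
proof -
  have fin: "finite (basis F (Suc i))" using resolution_finite[OF F] .
  obtain f' where f': "graded_linear F (Suc i) G (Suc i) f'"
    "\<And>v. v \<in> fmod F (Suc i) \<Longrightarrow> bmap G i (f' v) = f (bmap F i v)"
    using graded_linear_lift[OF G fin graded_linear_compose[OF graded_linear_bmap[OF F] f(1)]]
      f(2) cycle_bmap[OF F] by blast
  have "cycle I G (Suc i) (f' v)" if "cycle I F (Suc i) v" for v
    using that f'(2)[of v] graded_linear_fmod[OF f'(1) fin] graded_linear_0[OF f(1)]
    by (simp add: cycle_Suc)
  with f' show ?thesis using that by blast
qed

text \<open>
The chain maps \<open>f\<close> and \<open>g\<close> and the null homotopy \<open>h\<close> of \<open>id - g f\<close> are built one position at a
time. The map \<open>k\<close> is the second summand of the homotopy formula, the previous \<open>h\<close> composed with the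
boundary. The induction step uses it only through its vanishing on cycles, and the application only
through the last clause.
\<close>

lemma comparison_homotopy:
  fixes F G :: "('n::finite, 'k::field) free_cplx"
  assumes I: "homogeneous_ideal I" and F: "graded_free_resolution I F" and G: "graded_free_resolution I G"
  shows "\<exists>f g h k. graded_linear F i G i f \<and> graded_linear G i F i g \<and> graded_linear F i F (Suc i) h \<and>
    (\<forall>v. cycle I F i v \<longrightarrow> cycle I G i (f v)) \<and> (\<forall>v. cycle I G i v \<longrightarrow> cycle I F i (g v)) \<and>
    (\<forall>v\<in>fmod F i. v - g (f v) = bmap F i (h v) + k v) \<and>
    (\<forall>v. cycle I F i v \<longrightarrow> k v = 0) \<and>
    (\<forall>v\<in>fmod F i. (\<forall>j. i = Suc j \<longrightarrow> no_const (bmap F j v)) \<longrightarrow> no_const (k v))"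
proof (induction i)
  case 0
  have sub: "module.subspace (*) I" using I by (simp add: homogeneous_ideal_def)
  note finF = resolution_finite[OF F] and finG = resolution_finite[OF G]
  obtain f where f: "graded_linear F 0 G 0 f" "\<And>v. v \<in> fmod F 0 \<Longrightarrow> amap F v - amap G (f v) \<in> I"
    using comparison_map_0[OF I F G] by blast
  obtain g where g: "graded_linear G 0 F 0 g" "\<And>v. v \<in> fmod G 0 \<Longrightarrow> amap G v - amap F (g v) \<in> I"
    using comparison_map_0[OF I G F] by blast
  have "cycle I F 0 (v - g (f v))" if v: "v \<in> fmod F 0" for v
  proof -
    have fv: "f v \<in> fmod G 0" by (rule graded_linear_fmod[OF f(1) finF v])
    have "(amap F v - amap G (f v)) + (amap G (f v) - amap F (g (f v))) \<in> I"
      by (intro subspace_add[OF sub] f(2)[OF v] g(2)[OF fv])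
    then show ?thesis
      using v graded_linear_fmod[OF g(1) finG fv] by (simp add: cycle_0 amap_diff)
  qed
  then obtain h where h: "graded_linear F 0 F (Suc 0) h"
    "\<And>v. v \<in> fmod F 0 \<Longrightarrow> bmap F 0 (h v) = v - g (f v)"
    using graded_linear_lift[OF F finF graded_linear_minus[OF graded_linear_id graded_linear_compose[OF f(1) g(1)]]]
    by blast
  have "cycle I G 0 (f v)" if v: "cycle I F 0 v" for v
    using that subspace_diff[OF sub _ f(2)[of v], of "amap F v"] graded_linear_fmod[OF f(1) finF]
    by (simp add: cycle_0)
  moreover have "cycle I F 0 (g v)" if v: "cycle I G 0 v" for v
    using that subspace_diff[OF sub _ g(2)[of v], of "amap G v"] graded_linear_fmod[OF g(1) finG]
    by (simp add: cycle_0)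
  ultimately show ?case
    using f(1) g(1) h
    by (intro exI[of _ f] exI[of _ g] exI[of _ h] exI[of _ "\<lambda>_. 0"]) (simp add: no_const_def)
next
  case (Suc i)
  note finF = resolution_finite[OF F] and finG = resolution_finite[OF G]
  from Suc.IH obtain f g h k where f: "graded_linear F i G i f" and g: "graded_linear G i F i g"
    and h: "graded_linear F i F (Suc i) h"
    and cf: "\<And>v. cycle I F i v \<Longrightarrow> cycle I G i (f v)" and cg: "\<And>v. cycle I G i v \<Longrightarrow> cycle I F i (g v)"
    and hk: "\<And>v. v \<in> fmod F i \<Longrightarrow> v - g (f v) = bmap F i (h v) + k v"
    and k: "\<And>v. cycle I F i v \<Longrightarrow> k v = 0"
    by blast
  obtain f' where f': "graded_linear F (Suc i) G (Suc i) f'"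
    "\<And>v. v \<in> fmod F (Suc i) \<Longrightarrow> bmap G i (f' v) = f (bmap F i v)"
    "\<And>v. cycle I F (Suc i) v \<Longrightarrow> cycle I G (Suc i) (f' v)"
    using comparison_map_Suc[OF F G f cf] by blast
  obtain g' where g': "graded_linear G (Suc i) F (Suc i) g'"
    "\<And>v. v \<in> fmod G (Suc i) \<Longrightarrow> bmap F i (g' v) = g (bmap G i v)"
    "\<And>v. cycle I G (Suc i) v \<Longrightarrow> cycle I F (Suc i) (g' v)"
    using comparison_map_Suc[OF G F g cg] by blast
  define k' where "k' v = h (bmap F i v)" for v
  have lin: "graded_linear F (Suc i) F (Suc i) (\<lambda>v. (v - g' (f' v)) - k' v)"
    unfolding k'_def
    by (intro graded_linear_minus graded_linear_id graded_linear_compose[OF f'(1) g'(1)]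
        graded_linear_compose[OF graded_linear_bmap[OF F] h])
  have "cycle I F (Suc i) ((v - g' (f' v)) - k' v)" if v: "v \<in> fmod F (Suc i)" for v
  proof -
    have "f' v \<in> fmod G (Suc i)" by (rule graded_linear_fmod[OF f'(1) finF v])
    then have "bmap F i (v - g' (f' v)) = bmap F i v - g (f (bmap F i v))"
      by (simp add: bmap_diff g'(2) f'(2) v)
    also have "\<dots> = bmap F i (k' v)"
      using hk[of "bmap F i v"] k[OF cycle_bmap[OF F v]] by (simp add: k'_def)
    finally have "bmap F i ((v - g' (f' v)) - k' v) = 0"
      unfolding bmap_diff[of F i "v - g' (f' v)"] by simp
    then show ?thesis
      using graded_linear_fmod[OF lin finF v] by (simp add: cycle_Suc)
  qed
  then obtain h' where h': "graded_linear F (Suc i) F (Suc (Suc i)) h'"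
    "\<And>v. v \<in> fmod F (Suc i) \<Longrightarrow> bmap F (Suc i) (h' v) = (v - g' (f' v)) - k' v"
    using graded_linear_lift[OF F finF lin] by blast
  have "k' v = 0" if "cycle I F (Suc i) v" for v
    using that graded_linear_0[OF h] by (simp add: cycle_Suc k'_def)
  moreover have "no_const (k' v)" if "no_const (bmap F i v)" for v
    unfolding k'_def by (rule no_const_graded_linear[OF h finF fmod_bmap that])
  ultimately show ?case
    using f' g' h'
    by (intro exI[of _ f'] exI[of _ g'] exI[of _ h'] exI[of _ k']) simp
qed

text \<open>
If no basis element of \<open>G\<close> had the degree of \<open>a\<close>, then \<open>f\<close> would send the basis vector of \<open>a\<close> to a vector
without constant terms. The hypotheses on row and column do the same for the two homotopy terms, and
the equation \<open>e = g (f e) + d (h e) + k e\<close> for that basis vector \<open>e\<close> fails in the constant term of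
coordinate \<open>a\<close>.
\<close>

lemma degree_occurs_in_every_resolution:
  fixes F G :: "('n::finite, 'k::field) free_cplx"
  assumes I: "homogeneous_ideal I" and F: "graded_free_resolution I F" and G: "graded_free_resolution I G"
    and a: "a \<in> basis F i"
    and row: "\<And>b. b \<in> basis F (Suc i) \<Longrightarrow> Poly_Mapping.lookup (bdry F i a b) 0 = 0"
    and col: "\<And>j c. i = Suc j \<Longrightarrow> c \<in> basis F j \<Longrightarrow> Poly_Mapping.lookup (bdry F j c a) 0 = 0"
  shows "\<exists>b\<in>basis G i. bdeg G i b = bdeg F i a"
proof (rule ccontr)
  assume none: "\<not> ?thesis"
  note finF = resolution_finite[OF F] and finG = resolution_finite[OF G]
  obtain f g h k where f: "graded_linear F i G i f" and g: "graded_linear G i F i g"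
    and hk: "\<And>v. v \<in> fmod F i \<Longrightarrow> v - g (f v) = bmap F i (h v) + k v"
    and k: "\<And>v. v \<in> fmod F i \<Longrightarrow> (\<And>j. i = Suc j \<Longrightarrow> no_const (bmap F j v)) \<Longrightarrow> no_const (k v)"
    using comparison_homotopy[OF I F G, of i] by blast
  let ?e = "unit_vec a :: ('n, 'k) vec"
  have fe: "homogeneous_vec G i (bdeg F i a) (f ?e)"
    by (rule graded_linear_hom[OF f homogeneous_vec_unit_vec[OF a]])
  have "no_const (f ?e)"
    unfolding no_const_def
  proof
    fix b show "Poly_Mapping.lookup (f ?e b) 0 = 0"
    proof (cases "b \<in> basis G i")
      case True
      with fe none have "homogeneous (bdeg G i b) (bdeg F i a) (f ?e b)" "bdeg G i b \<noteq> bdeg F i a"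
        by (auto simp: homogeneous_vec_def)
      then have "0 \<notin> Poly_Mapping.keys (f ?e b)"
        by (auto simp: homogeneous_def mdegree_def)
      then show ?thesis by (simp add: in_keys_iff)
    next
      case False
      with fe show ?thesis by (simp add: homogeneous_vec_def fmod_def)
    qed
  qed
  moreover have "f ?e \<in> fmod G i"
    using fe by (simp add: homogeneous_vec_def)
  ultimately have "no_const (g (f ?e))"
    using no_const_graded_linear[OF g finG] by blast
  then have "Poly_Mapping.lookup (g (f ?e) a) 0 = 0" by (simp add: no_const_def)
  moreover have "Poly_Mapping.lookup (bmap F i (h ?e) a) 0 = 0"
    using row by (simp add: bmap_def lookup_sum lookup_mult_0_left)
  moreover have "Poly_Mapping.lookup (k ?e a) 0 = 0"
  proof -
    have "no_const (bmap F j ?e)" if "i = Suc j" for j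
      using bmap_unit_vec[of F j a] finF a col that by (simp add: no_const_def)
    then have "no_const (k ?e)" using k a by simp
    then show ?thesis by (simp add: no_const_def)
  qed
  moreover have "?e a - g (f ?e) a = bmap F i (h ?e) a + k ?e a"
    using fun_cong[OF hk[of ?e], of a] a by simp
  then have "Poly_Mapping.lookup (?e a - g (f ?e) a) 0 = Poly_Mapping.lookup (bmap F i (h ?e) a + k ?e a) 0"
    by simp
  ultimately have "Poly_Mapping.lookup (?e a) 0 = 0"
    by (simp add: lookup_add lookup_minus)
  then show False by (simp add: unit_vec_def)
qed

section \<open>Minimal resolutions exist\<close>

lemma graded_free_resolutionI:
  assumes "\<And>i. finite (basis F i)"
    and "\<And>a. a \<in> basis F 0 \<Longrightarrow> homogeneous 0 (bdeg F 0 a) (aug F a)"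
    and "\<And>i a b. a \<in> basis F i \<Longrightarrow> b \<in> basis F (Suc i) \<Longrightarrow>
           homogeneous (bdeg F i a) (bdeg F (Suc i) b) (bdry F i a b)"
    and "\<And>p. \<exists>v\<in>fmod F 0. p - amap F v \<in> I"
    and exact: "\<And>i v. cycle I F i v \<longleftrightarrow> v \<in> bmap F i ` fmod F (Suc i)"
  shows "graded_free_resolution I F"
proof -
  have "bmap F 0 ` fmod F 1 = {v \<in> fmod F 0. amap F v \<in> I}"
    using exact[of 0] by (auto simp: cycle_0)
  moreover have "bmap F (Suc i) ` fmod F (Suc (Suc i)) = {v \<in> fmod F (Suc i). bmap F i v = 0}" for i
    using exact[of "Suc i"] by (auto simp: cycle_Suc)
  ultimately show ?thesis
    unfolding graded_free_resolution_def by (intro conjI allI ballI assms(1-4))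
qed

text \<open>
Homogeneity makes an entry with nonzero constant term a nonzero scalar, hence invertible.
\<close>

lemma homogeneous_unit:
  assumes "homogeneous d e p" "Poly_Mapping.lookup p 0 \<noteq> 0"
  shows "d = e" "p = Poly_Mapping.single 0 (Poly_Mapping.lookup p 0)"
proof -
  have z: "mdegree (0 :: 'a \<Rightarrow> nat) = 0" by (simp add: mdegree_def)
  show "d = e"
    using assms z by (auto simp: homogeneous_def in_keys_iff)
  show "p = Poly_Mapping.single 0 (Poly_Mapping.lookup p 0)"
  proof (rule poly_mapping_eqI)
    fix t
    show "Poly_Mapping.lookup p t = Poly_Mapping.lookup (Poly_Mapping.single 0 (Poly_Mapping.lookup p 0)) t"
    proof (cases "t = 0")
      case False
      then have "mdegree t \<noteq> 0"
        by (auto simp: mdegree_def fun_eq_iff)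
      with assms(1) \<open>d = e\<close> have "Poly_Mapping.lookup p t = 0"
        unfolding homogeneous_def by (metis add_right_cancel add_0 in_keys_iff)
      with False show ?thesis by (simp add: lookup_single)
    qed simp
  qed
qed

definition total_basis :: "('n::finite, 'k::field) free_cplx \<Rightarrow> (nat \<times> nat) set" where
  "total_basis F = (SIGMA i:UNIV. basis F i)"

text \<open>
Gaussian elimination. The entry at \<open>(a0, b0)\<close> is an invertible scalar, so \<open>b0\<close> and its boundary span an
exact direct summand, and it can be split off. Concretely, vectors without coordinate \<open>b0\<close> are
identified with vectors whose boundary has no coordinate \<open>a0\<close> (\<open>lift\<close> and \<open>proj\<close> below), and modulo
the boundary of \<open>b0\<close> every vector can be cleared of its coordinate \<open>a0\<close> (\<open>clear\<close>).
\<close>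

lemma cancel_unit_entry:
  fixes F :: "('n::finite, 'k::field) free_cplx"
  assumes I: "module.subspace (*) I" and F: "graded_free_resolution I F"
    and a0: "a0 \<in> basis F i" and b0: "b0 \<in> basis F (Suc i)"
    and unit: "Poly_Mapping.lookup (bdry F i a0 b0) 0 \<noteq> 0"
  obtains F' :: "('n, 'k) free_cplx" where "graded_free_resolution I F'"
    and "total_basis F' = total_basis F - {(i, a0), (Suc i, b0)}"
proof -
  note fin = resolution_finite[OF F]
  note hom = resolution_bdry[OF F]
  define c where "c = Poly_Mapping.lookup (bdry F i a0 b0) 0"
  define q where "q = (Poly_Mapping.single 0 (inverse c) :: ('n, 'k) poly_ring)"
  have pivot: "bdry F i a0 b0 = Poly_Mapping.single 0 c"
    using homogeneous_unit(2)[OF hom[OF a0 b0] unit] by (simp add: c_def)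
  have c: "c \<noteq> 0" using unit by (simp add: c_def)
  have q: "q * bdry F i a0 b0 = 1"
    using c by (simp add: pivot q_def mult_single)
  have deg: "bdeg F i a0 = bdeg F (Suc i) b0"
    using homogeneous_unit(1)[OF hom[OF a0 b0] unit] .
  have q_hom: "homogeneous d d q" for d
    by (simp add: q_def homogeneous_def mdegree_def)

  define B where "B j = {a \<in> basis F j. (j, a) \<noteq> (i, a0) \<and> (j, a) \<noteq> (Suc i, b0)}" for j
  \<comment> \<open>Row elimination: the multiple of row \<open>a0\<close> that clears column \<open>b0\<close> is subtracted from row \<open>a\<close>.\<close>
  define M where "M j a b = (if j = i then bdry F i a b - bdry F i a b0 * (q * bdry F i a0 b) else bdry F j a b)" for j a b
  define F' :: "('n, 'k) free_cplx" where
    "F' = \<lparr>basis = B, bdeg = bdeg F, bdry = M, aug = aug F\<rparr>"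
  have F'[simp]: "basis F' = B" "bdeg F' = bdeg F" "bdry F' = M" "aug F' = aug F"
    by (simp_all add: F'_def)
  have B_other: "B j = basis F j" if "j \<noteq> i" "j \<noteq> Suc i" for j
    using that by (auto simp: B_def)
  have B_i: "B i = basis F i - {a0}" and B_Si: "B (Suc i) = basis F (Suc i) - {b0}"
    by (auto simp: B_def)
  have B_sub: "B j \<subseteq> basis F j" for j by (auto simp: B_def)
  have finB: "finite (B j)" for j using B_sub fin finite_subset by blast
  have fmod_iff: "v \<in> fmod F' j \<longleftrightarrow> v \<in> fmod F j \<and> (j = i \<longrightarrow> v a0 = 0) \<and> (j = Suc i \<longrightarrow> v b0 = 0)" for v j
    using a0 b0 by (auto simp: fmod_def B_def)
  have fmod_sub: "v \<in> fmod F' j \<Longrightarrow> v \<in> fmod F j" for v j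
    by (simp add: fmod_iff)

  define r where "r w = bmap F i w a0" for w
  \<comment> \<open>The correction along \<open>b0\<close> removes coordinate \<open>a0\<close> from the boundary of \<open>w\<close>.\<close>
  define lift where "lift w = w - smul (q * r w) (unit_vec b0)" for w
  define proj where "proj w = w(b0 := 0)" for w :: "('n, 'k) vec"
  define d0 where "d0 = bmap F i (unit_vec b0)"
  have d0_a0: "d0 a0 = bdry F i a0 b0"
    using a0 b0 fin by (simp add: d0_def bmap_unit_vec)
  have d0: "d0 a = (if a \<in> basis F i then bdry F i a b0 else 0)" for a
    using b0 fin by (simp add: d0_def bmap_unit_vec)
  have q': "(q * x) * bdry F i a0 b0 = x" for x
    using q by (metis mult.assoc mult.commute mult.right_neutral)
  have lift_fmod: "lift w \<in> fmod F (Suc i)" if "w \<in> fmod F (Suc i)" for w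
    using that b0 by (simp add: lift_def)
  have bmap_lift: "bmap F i (lift w) = bmap F i w - smul (q * r w) d0" for w
    by (simp add: lift_def bmap_diff bmap_smul d0_def)
  have bmap_lift_a0: "bmap F i (lift w) a0 = 0" for w
    by (simp add: bmap_lift smul_def d0_a0 q' r_def)
  have proj_lift: "proj (lift w) = w" if "w b0 = 0" for w
    using that by (auto simp: proj_def lift_def smul_def unit_vec_def)
  have lift_proj: "lift (proj w) = w" if "r w = 0" for w
  proof -
    have "proj w = w - smul (w b0) (unit_vec b0)"
      by (auto simp: proj_def smul_def unit_vec_def)
    then have "bmap F i (proj w) = bmap F i w - smul (w b0) d0"
      by (simp only: bmap_diff bmap_smul d0_def)
    then have "r (proj w) = - (w b0 * bdry F i a0 b0)"
      using that by (simp add: r_def smul_def d0_a0)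
    then have "q * r (proj w) = - ((q * w b0) * bdry F i a0 b0)"
      by (simp only: mult_minus_right mult.assoc)
    then have "q * r (proj w) = - w b0"
      by (simp only: q')
    then show ?thesis
      by (auto simp: lift_def proj_def smul_def unit_vec_def)
  qed
  have proj_fmod: "proj w \<in> fmod F' (Suc i)" if "w \<in> fmod F (Suc i)" for w
    using that by (auto simp: proj_def fmod_def B_Si)

  have bmap_i: "bmap F' i w = bmap F i (lift w)" if w: "w \<in> fmod F' (Suc i)" for w
  proof (rule ext)
    fix a
    have wb0: "w b0 = 0" using w by (simp add: fmod_iff)
    show "bmap F' i w a = bmap F i (lift w) a"
    proof (cases "a \<in> B i")
      case True
      then have a: "a \<in> basis F i" by (simp add: B_i)
      have "bmap F' i w a = (\<Sum>b\<in>basis F (Suc i) - {b0}. bdry F i a b * w b - bdry F i a b0 * q * (bdry F i a0 b * w b))"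
        using True by (simp add: bmap_def M_def B_Si algebra_simps)
      also have "\<dots> = (\<Sum>b\<in>basis F (Suc i). bdry F i a b * w b - bdry F i a b0 * q * (bdry F i a0 b * w b))"
        using wb0 fin by (intro sum.mono_neutral_left) auto
      also have "\<dots> = bmap F i w a - bdry F i a b0 * q * r w"
        using a a0 by (simp add: bmap_def r_def sum_subtractf sum_distrib_left)
      also have "\<dots> = bmap F i (lift w) a"
        using a by (simp add: bmap_lift smul_def d0 algebra_simps)
      finally show ?thesis .
    next
      case False
      then have "a = a0 \<or> a \<notin> basis F i" by (auto simp: B_i)
      then have "bmap F i (lift w) a = 0"
        using bmap_lift_a0 by (auto simp: bmap_def)
      with False show ?thesis by (simp add: bmap_def)
    qed
  qed
  have bmap_Si: "bmap F' (Suc i) w = proj (bmap F (Suc i) w)" for w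
    by (auto simp: bmap_def proj_def M_def B_Si B_other)
  have bmap_other: "bmap F' j w = bmap F j w" if "j \<noteq> i" "j \<noteq> Suc i" "w \<in> fmod F' (Suc j)" for j w
  proof (rule ext)
    fix a
    have "(\<Sum>b\<in>B (Suc j). bdry F j a b * w b) = (\<Sum>b\<in>basis F (Suc j). bdry F j a b * w b)"
      using that(3) fin B_sub by (intro sum.mono_neutral_left) (auto simp: fmod_def)
    then show "bmap F' j w a = bmap F j w a"
      using that(1,2) B_other by (simp add: bmap_def M_def)
  qed
  have amap': "amap F' v = amap F v" if "v \<in> fmod F' 0" for v
    unfolding amap_def F' using that fin B_sub
    by (intro sum.mono_neutral_left) (auto simp: fmod_def)
  \<comment> \<open>Subtracting a multiple of the boundary of \<open>b0\<close> removes coordinate \<open>a0\<close> and changes the vector only by a cycle.\<close>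
  define clear where "clear v = v - smul (q * v a0) d0" for v
  have clear_fmod: "clear v \<in> fmod F' i" if "v \<in> fmod F i" for v
  proof -
    have "clear v a0 = 0" by (simp add: clear_def smul_def d0_a0 q')
    moreover have "clear v \<in> fmod F i" using that by (simp add: clear_def d0_def)
    ultimately show ?thesis by (simp add: fmod_iff)
  qed
  have d0_cycle: "cycle I F i d0"
    using cycle_bmap[OF F] b0 by (simp add: d0_def)
  have "graded_free_resolution I F'"
  proof (rule graded_free_resolutionI)
    show "finite (basis F' j)" for j using finB by simp
    show "homogeneous 0 (bdeg F' 0 a) (aug F' a)" if "a \<in> basis F' 0" for a
      using that B_sub resolution_aug[OF F] by auto
    show "homogeneous (bdeg F' j a) (bdeg F' (Suc j) b) (bdry F' j a b)"
      if "a \<in> basis F' j" "b \<in> basis F' (Suc j)" for j a b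
    proof -
      have ab: "a \<in> basis F j" "b \<in> basis F (Suc j)" using that B_sub by auto
      have "homogeneous (bdeg F j a) (bdeg F (Suc j) b) (bdry F j a b0 * (q * bdry F j a0 b))" if "j = i"
        using homogeneous_mult[OF _ homogeneous_mult[OF q_hom], of "bdeg F i a" "bdeg F (Suc i) b0"]
          hom[of a i b0] hom[of a0 i b] ab that a0 b0 deg by simp
      with hom[OF ab] show ?thesis
        by (auto simp: M_def intro!: homogeneous_diff)
    qed
    show "\<exists>v\<in>fmod F' 0. p - amap F' v \<in> I" for p
    proof -
      obtain v where v: "v \<in> fmod F 0" "p - amap F v \<in> I"
        using resolution_surj[OF F] by blast
      show ?thesis
      proof (cases "i = 0")
        case True
        have cv: "clear v \<in> fmod F' 0" using clear_fmod v(1) True by simp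
        have "amap F d0 \<in> I" using d0_cycle True by (simp add: cycle_0)
        then have "(p - amap F v) + (q * v a0) * amap F d0 \<in> I"
          by (intro subspace_add[OF I] subspace_mult[OF I] v(2))
        then have "p - amap F' (clear v) \<in> I"
          unfolding amap'[OF cv] by (simp add: clear_def amap_diff amap_smul algebra_simps)
        with cv show ?thesis by blast
      next
        case False
        with v have "v \<in> fmod F' 0" by (simp add: fmod_iff)
        with v amap' show ?thesis by auto
      qed
    qed
    show "cycle I F' j v \<longleftrightarrow> v \<in> bmap F' j ` fmod F' (Suc j)" for j v
    proof -
      have cycle_other: "cycle I F' j v \<longleftrightarrow> v \<in> fmod F' j \<and> cycle I F j v"
        if "j \<noteq> Suc i" "j \<noteq> Suc (Suc i)"
      proof (cases j)
        case 0
        then show ?thesis using amap' fmod_sub by (auto simp: cycle_0)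
      next
        case (Suc k)
        then show ?thesis using bmap_other[of k v] that fmod_sub by (auto simp: cycle_Suc)
      qed
      \<comment> \<open>Only the positions next to the two removed basis elements differ from \<open>F\<close>.\<close>
      consider "j = i" | "j = Suc i" | "j = Suc (Suc i)" | "Suc j = i"
        | "j \<noteq> i" "j \<noteq> Suc i" "j \<noteq> Suc (Suc i)" "Suc j \<noteq> i"
        by blast
      then show ?thesis
      proof cases
        case 1
        show ?thesis
        proof
          assume "cycle I F' j v"
          then have v: "v \<in> fmod F' i" "cycle I F i v" using cycle_other 1 by auto
          then obtain w where w: "w \<in> fmod F (Suc i)" "v = bmap F i w"
            using resolution_exact[OF F] by blast
          with v have "r w = 0" by (simp add: r_def fmod_iff)
          then have "v = bmap F' i (proj w)"
            using w by (simp add: bmap_i proj_fmod lift_proj)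
          then show "v \<in> bmap F' j ` fmod F' (Suc j)"
            using proj_fmod w 1 by blast
        next
          assume "v \<in> bmap F' j ` fmod F' (Suc j)"
          then obtain w where w: "w \<in> fmod F' (Suc i)" "v = bmap F' i w" using 1 by blast
          have "cycle I F i v"
            using w cycle_bmap[OF F lift_fmod[OF fmod_sub[OF w(1)]]] by (simp add: bmap_i)
          moreover have "v \<in> fmod F' i"
            using w(2) by simp
          ultimately show "cycle I F' j v" using cycle_other 1 by simp
        qed
      next
        case 2
        show ?thesis
        proof
          assume "cycle I F' j v"
          then have v: "v \<in> fmod F' (Suc i)" "bmap F i (lift v) = 0"
            using 2 by (auto simp: cycle_Suc bmap_i)
          then have "cycle I F (Suc i) (lift v)"
            using lift_fmod fmod_sub by (simp add: cycle_Suc)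
          then obtain x where x: "x \<in> fmod F (Suc (Suc i))" "lift v = bmap F (Suc i) x"
            using resolution_exact[OF F] by blast
          have "v = bmap F' (Suc i) x"
            using v(1) by (simp add: bmap_Si x(2)[symmetric] proj_lift fmod_iff)
          then show "v \<in> bmap F' j ` fmod F' (Suc j)"
            using x 2 by (auto simp: fmod_iff)
        next
          assume "v \<in> bmap F' j ` fmod F' (Suc j)"
          then obtain x where x: "x \<in> fmod F (Suc (Suc i))" "v = proj (bmap F (Suc i) x)"
            using 2 bmap_Si fmod_sub by auto
          have z: "bmap F i (bmap F (Suc i) x) = 0"
            using cycle_bmap[OF F x(1)] by (simp add: cycle_Suc)
          then have "bmap F i (lift v) = 0"
            by (simp add: x(2) lift_proj r_def)
          moreover have "v \<in> fmod F' (Suc i)" unfolding x(2) by (rule proj_fmod) simp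
          ultimately show "cycle I F' j v"
            using 2 by (simp add: cycle_Suc bmap_i)
        qed
      next
        case 3
        have bm: "bmap F' j w = bmap F j w" if "w \<in> fmod F' (Suc j)" for w
          using that 3 by (intro bmap_other) auto
        have fm: "fmod F' k = fmod F k" if "k \<ge> Suc (Suc i)" for k
          using that by (auto simp: fmod_iff)
        have z: "proj (bmap F (Suc i) v) = 0 \<longleftrightarrow> bmap F (Suc i) v = 0" if "v \<in> fmod F (Suc (Suc i))"
        proof
          assume "proj (bmap F (Suc i) v) = 0"
          moreover have "r (bmap F (Suc i) v) = 0"
            using cycle_bmap[OF F that] by (simp add: cycle_Suc r_def)
          ultimately have "bmap F (Suc i) v = lift 0" using lift_proj by metis
          then show "bmap F (Suc i) v = 0" by (simp add: lift_def r_def smul_def fun_eq_iff)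
        qed (auto simp: proj_def)
        have "cycle I F' j v \<longleftrightarrow> cycle I F j v"
          using 3 z by (auto simp: cycle_Suc bmap_Si fm)
        moreover have "bmap F' j ` fmod F' (Suc j) = bmap F j ` fmod F (Suc j)"
        proof (rule image_cong)
          show "fmod F' (Suc j) = fmod F (Suc j)" by (rule fm) (simp add: 3)
        qed (rule bm, simp add: fm 3)
        ultimately show ?thesis by (simp only: resolution_exact[OF F])
      next
        case 4
        have bm: "bmap F' j w = bmap F j w" if "w \<in> fmod F' (Suc j)" for w
          by (rule bmap_other[OF _ _ that]) (use 4 in linarith)+
        have z: "bmap F j d0 = 0"
          using d0_cycle 4 by (auto simp: cycle_Suc)
        have im: "bmap F' j ` fmod F' (Suc j) = bmap F j ` fmod F (Suc j)"
        proof
          show "bmap F' j ` fmod F' (Suc j) \<subseteq> bmap F j ` fmod F (Suc j)"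
            using bm fmod_sub by auto
          show "bmap F j ` fmod F (Suc j) \<subseteq> bmap F' j ` fmod F' (Suc j)"
          proof (rule image_subsetI)
            fix w assume w: "w \<in> fmod F (Suc j)"
            then have cw: "clear w \<in> fmod F' (Suc j)" using clear_fmod 4 by simp
            have "smul (q * w a0) 0 = 0" by (simp add: smul_def fun_eq_iff)
            then have "bmap F j (clear w) = bmap F j w"
              by (simp add: clear_def bmap_diff bmap_smul z)
            then have "bmap F j w = bmap F' j (clear w)"
              by (simp only: bm[OF cw])
            with cw show "bmap F j w \<in> bmap F' j ` fmod F' (Suc j)" by blast
          qed
        qed
        have ji: "j \<noteq> i" "j \<noteq> Suc i" "j \<noteq> Suc (Suc i)" using 4 by linarith+
        then have "v \<in> fmod F' j \<longleftrightarrow> v \<in> fmod F j" by (simp add: fmod_iff)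
        then have "cycle I F' j v \<longleftrightarrow> cycle I F j v"
          using cycle_other[OF ji(2,3)] unfolding cycle_def by blast
        with im show ?thesis by (simp only: resolution_exact[OF F])
      next
        case 5
        have bm: "bmap F' j w = bmap F j w" if "w \<in> fmod F' (Suc j)" for w
          by (rule bmap_other[OF 5(1,2) that])
        have fm: "fmod F' (Suc j) = fmod F (Suc j)" "fmod F' j = fmod F j"
          using 5 by (auto simp: fmod_iff)
        have "cycle I F' j v \<longleftrightarrow> cycle I F j v"
          using cycle_other[OF 5(2,3)] unfolding fm(2) cycle_def by blast
        moreover have "bmap F' j ` fmod F' (Suc j) = bmap F j ` fmod F (Suc j)"
          by (rule image_cong[OF fm(1)]) (rule bm, simp only: fm(1))
        ultimately show ?thesis by (simp only: resolution_exact[OF F])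
      qed
    qed
  qed
  moreover have "total_basis F' = total_basis F - {(i, a0), (Suc i, b0)}"
    by (auto simp: total_basis_def B_def)
  ultimately show ?thesis using that by blast
qed

text \<open>
Each cancellation removes two basis elements, so it can be repeated only finitely often.
\<close>

lemma minimal_resolution_exists:
  fixes F :: "('n::finite, 'k::field) free_cplx"
  assumes I: "module.subspace (*) I" and "graded_free_resolution I F" and "finite (total_basis F)"
  shows "\<exists>F :: ('n, 'k) free_cplx. minimal_graded_free_resolution I F"
  using assms(2,3)
proof (induction "card (total_basis F)" arbitrary: F rule: less_induct)
  case less
  show ?case
  proof (cases "minimal_graded_free_resolution I F")
    case False
    then obtain i a b where ab: "a \<in> basis F i" "b \<in> basis F (Suc i)"
      "Poly_Mapping.lookup (bdry F i a b) 0 \<noteq> 0"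
      using less.prems(1) by (auto simp: minimal_graded_free_resolution_def)
    obtain F' :: "('n, 'k) free_cplx" where F': "graded_free_resolution I F'"
      and tb: "total_basis F' = total_basis F - {(i, a), (Suc i, b)}"
      using cancel_unit_entry[OF I less.prems(1) ab] by blast
    have "(i, a) \<in> total_basis F" using ab by (simp add: total_basis_def)
    then have "total_basis F' \<subset> total_basis F" using tb by auto
    then have "card (total_basis F') < card (total_basis F)"
      using less.prems(2) by (rule psubset_card_mono[rotated])
    moreover have "finite (total_basis F')" using less.prems(2) tb by simp
    ultimately show ?thesis using less.hyps F' by blast
  qed blast
qed

section \<open>Monomial ideals\<close>

text \<open>
Membership is tested monomial by monomial; \<open>ideal_generated_mon\<close> identifies this set with the ideal
generated by the monomials in \<open>G\<close>.
\<close>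

definition monomial_ideal :: "'n monomial set \<Rightarrow> ('n::finite, 'k::field) poly_ring set" where
  "monomial_ideal G = {p. \<forall>t\<in>Poly_Mapping.keys p. \<exists>g\<in>G. g \<le> t}"

lemma mem_monomial_ideal_set:
  "p \<in> monomial_ideal (set gs) \<longleftrightarrow> (\<forall>t\<in>Poly_Mapping.keys p. \<exists>q<length gs. gs ! q \<le> t)"
  unfolding monomial_ideal_def by (simp add: set_conv_nth) blast

lemma keys_mon [simp]: "Poly_Mapping.keys (mon t :: ('n::finite, 'k::field) poly_ring) = {t}"
  by (simp add: mon_def)

lemma subspace_monomial_ideal: "module.subspace (*) (monomial_ideal G :: ('n::finite, 'k::field) poly_ring set)"
proof -
  have "p + q \<in> monomial_ideal G" if "p \<in> monomial_ideal G" "q \<in> monomial_ideal G" for p q :: "('n, 'k) poly_ring"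
    using that keys_add[of p q] by (auto simp: monomial_ideal_def)
  moreover have "c * p \<in> monomial_ideal G" if "p \<in> monomial_ideal G" for c p :: "('n, 'k) poly_ring"
    unfolding monomial_ideal_def
  proof (clarify)
    fix t assume "t \<in> Poly_Mapping.keys (c * p)"
    then obtain u s where t: "t = u + s" "s \<in> Poly_Mapping.keys p"
      using keys_mult[of c p] by blast
    then obtain g where "g \<in> G" "g \<le> s" using \<open>p \<in> monomial_ideal G\<close> by (auto simp: monomial_ideal_def)
    moreover have "s \<le> t" by (simp add: t le_fun_def)
    ultimately show "\<exists>g\<in>G. g \<le> t" by (meson order_trans)
  qed
  moreover have "0 \<in> (monomial_ideal G :: ('n, 'k) poly_ring set)"
    by (simp add: monomial_ideal_def)
  ultimately show ?thesis
    unfolding module.subspace_def[OF module_times] by blast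
qed

lemma ideal_generated_mon: "ideal_generated (mon ` G) = (monomial_ideal G :: ('n::finite, 'k::field) poly_ring set)"
proof
  show "ideal_generated (mon ` G) \<subseteq> (monomial_ideal G :: ('n, 'k) poly_ring set)"
    by (intro module.span_minimal[OF module_times] subspace_monomial_ideal) (auto simp: monomial_ideal_def)
  show "(monomial_ideal G :: ('n, 'k) poly_ring set) \<subseteq> ideal_generated (mon ` G)"
  proof
    fix p :: "('n, 'k) poly_ring" assume p: "p \<in> monomial_ideal G"
    have "p = (\<Sum>t\<in>Poly_Mapping.keys p. Poly_Mapping.single t (Poly_Mapping.lookup p t))"
      by (rule poly_mapping_eqI) (simp add: lookup_sum lookup_single when_def in_keys_iff)
    also have "\<dots> \<in> ideal_generated (mon ` G)"
    proof (rule module.span_sum[OF module_times])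
      fix t assume "t \<in> Poly_Mapping.keys p"
      then obtain g where g: "g \<in> G" "g \<le> t" using p by (auto simp: monomial_ideal_def)
      then have "t = (t - g) + g" by (auto simp: fun_eq_iff le_fun_def)
      then have "Poly_Mapping.single t c = Poly_Mapping.single (t - g) c * mon g" for c :: 'k
        by (simp add: mon_def mult_single)
      then show "Poly_Mapping.single t (Poly_Mapping.lookup p t) \<in> ideal_generated (mon ` G)"
        using g(1) by (auto intro: module.span_scale[OF module_times] module.span_base[OF module_times])
    qed
    finally show "p \<in> ideal_generated (mon ` G)" .
  qed
qed

lemma homogeneous_monomial_ideal: "homogeneous_ideal (monomial_ideal G)"
  unfolding homogeneous_ideal_def
  by (auto simp: subspace_monomial_ideal) (auto simp: monomial_ideal_def in_keys_iff lookup_hpart split: if_splits)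

lemma monomial_diff_eq_0_iff: "s - t = 0 \<longleftrightarrow> s \<le> t" for s t :: "'n monomial"
  by (simp add: fun_eq_iff le_fun_def)

lemma mdegree_mono: "s \<le> t \<Longrightarrow> mdegree s \<le> mdegree t"
  unfolding mdegree_def by (rule sum_mono) (simp add: le_fun_def)

lemma mdegree_strict_mono:
  assumes "s \<le> t" "s \<noteq> t"
  shows "mdegree s < mdegree t"
proof -
  obtain v where "s v \<noteq> t v" using assms(2) by auto
  with assms(1) have "s v < t v" by (simp add: le_fun_def le_neq_implies_less)
  then show ?thesis
    unfolding mdegree_def using assms(1) by (intro sum_strict_mono_ex1) (auto simp: le_fun_def)
qed

text \<open>
The degree drops strictly along proper divisors, so descending to smaller monomials of \<open>I\<close> stops at a
minimal one.
\<close>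

lemma min_gens_below: "mon t \<in> I \<Longrightarrow> \<exists>g\<in>min_gens I. g \<le> t"
proof (induction "mdegree t" arbitrary: t rule: less_induct)
  case less
  show ?case
  proof (cases "t \<in> min_gens I")
    case False
    then obtain u where u: "mon u \<in> I" "u \<le> t" "u \<noteq> t"
      using less.prems by (auto simp: min_gens_def)
    then obtain g where "g \<in> min_gens I" "g \<le> u" using less.hyps mdegree_strict_mono by blast
    with u(2) show ?thesis by (meson order_trans)
  qed auto
qed

lemma squarefree_monomial_ideal_min_gens:
  fixes I :: "('n::finite, 'k::field) poly_ring set"
  assumes "squarefree_monomial_ideal I"
  shows "I = monomial_ideal (min_gens I)" and "g \<in> min_gens I \<Longrightarrow> g v \<le> 1"
proof -
  obtain M where M: "\<And>t v. t \<in> M \<Longrightarrow> t v \<le> 1" "I = monomial_ideal M"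
    using assms by (auto simp: squarefree_monomial_ideal_def ideal_generated_mon)
  have mon: "mon t \<in> I \<longleftrightarrow> (\<exists>m\<in>M. m \<le> t)" for t
    by (simp add: M(2) monomial_ideal_def)
  have "(\<exists>m\<in>M. m \<le> t) \<longleftrightarrow> (\<exists>g\<in>min_gens I. g \<le> t)" for t
  proof
    assume "\<exists>m\<in>M. m \<le> t"
    then show "\<exists>g\<in>min_gens I. g \<le> t" using min_gens_below[of t I] mon by simp
  next
    assume "\<exists>g\<in>min_gens I. g \<le> t"
    then obtain g m where "g \<le> t" "m \<in> M" "m \<le> g" using mon by (auto simp: min_gens_def)
    then show "\<exists>m\<in>M. m \<le> t" by (meson order_trans)
  qed
  then show "I = monomial_ideal (min_gens I)"
    by (subst M(2)) (simp add: monomial_ideal_def)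
  assume g: "g \<in> min_gens I"
  then obtain m where m: "m \<in> M" "m \<le> g" using mon by (auto simp: min_gens_def)
  then have "m = g" using g mon by (auto simp: min_gens_def)
  with m M(1) show "g v \<le> 1" by auto
qed

lemma lcm_list_le_iff: "lcm_list ts \<le> t \<longleftrightarrow> (\<forall>x\<in>set ts. x \<le> t)"
proof (induction ts)
  case Nil
  then show ?case by (simp add: lcm_list_def le_fun_def)
next
  case (Cons x ts)
  then show ?case by (simp add: lcm_list_def del: sup_apply)
qed

lemma le_lcm_list: "x \<in> set ts \<Longrightarrow> x \<le> lcm_list ts"
  using lcm_list_le_iff[of ts "lcm_list ts"] by simp

lemma lcm_list_mono: "set xs \<subseteq> set ys \<Longrightarrow> lcm_list xs \<le> lcm_list ys"
  using lcm_list_le_iff[of xs "lcm_list ys"] le_lcm_list[of _ ys] by blast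

lemma lcm_list_pos: "0 < lcm_list xs v \<Longrightarrow> \<exists>x\<in>set xs. 0 < x v"
  by (induction xs) (auto simp: lcm_list_def sup_max max_def split: if_splits)

section \<open>The Lyubeznik resolution\<close>

definition cell_lcm :: "'n monomial list \<Rightarrow> nat set \<Rightarrow> 'n monomial" where
  "cell_lcm gs \<sigma> = lcm_list (map ((!) gs) (sorted_list_of_set \<sigma>))"

text \<open>
The cells of the Lyubeznik complex: no generator preceding \<open>q\<close> divides the lcm of the tail of the cell
that starts at \<open>q\<close>. The list \<open>gs\<close> fixes the order of the generators.
\<close>

definition admissible :: "'n monomial list \<Rightarrow> nat set \<Rightarrow> bool" where
  "admissible gs \<sigma> \<longleftrightarrow> \<sigma> \<subseteq> {..<length gs} \<and>
     (\<forall>q\<in>\<sigma>. \<forall>p<q. \<not> gs ! p \<le> cell_lcm gs (\<sigma> \<inter> {q..}))"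

text \<open>
The sign of the face obtained by deleting \<open>p\<close> from \<open>insert p \<sigma>\<close>, where \<open>p \<notin> \<sigma>\<close>.
\<close>

definition face_sign :: "nat \<Rightarrow> nat set \<Rightarrow> 'k::field" where
  "face_sign p \<sigma> = (- 1) ^ card {x \<in> \<sigma>. x < p}"

text \<open>
Cells are finite sets of positions in \<open>gs\<close>, encoded as natural numbers. The empty cell spans \<open>F\<^sub>0 = S\<close>. A
cell of cardinality \<open>i\<close> that is contained in a cell of cardinality \<open>i + 1\<close> differs from it by a
singleton, whose member \<open>the_elem\<close> extracts.
\<close>

definition lyubeznik :: "'n monomial list \<Rightarrow> ('n::finite, 'k::field) free_cplx" where
  "lyubeznik gs =
     \<lparr>basis = (\<lambda>i. set_encode ` {\<sigma>. admissible gs \<sigma> \<and> card \<sigma> = i}),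
      bdeg = (\<lambda>i a. mdegree (cell_lcm gs (set_decode a))),
      bdry = (\<lambda>i a b. let \<sigma> = set_decode a; \<tau> = set_decode b in
         if \<sigma> \<subseteq> \<tau>
         then Poly_Mapping.single (cell_lcm gs \<tau> - cell_lcm gs \<sigma>) (face_sign (the_elem (\<tau> - \<sigma>)) \<sigma>)
         else 0),
      aug = (\<lambda>a. 1)\<rparr>"

lemma cell_lcm_le_iff: "finite \<sigma> \<Longrightarrow> cell_lcm gs \<sigma> \<le> t \<longleftrightarrow> (\<forall>q\<in>\<sigma>. gs ! q \<le> t)"
  by (simp add: cell_lcm_def lcm_list_le_iff)

lemma le_cell_lcm: "finite \<sigma> \<Longrightarrow> q \<in> \<sigma> \<Longrightarrow> gs ! q \<le> cell_lcm gs \<sigma>"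
  using cell_lcm_le_iff[of \<sigma> gs "cell_lcm gs \<sigma>"] by simp

lemma cell_lcm_mono: "finite \<tau> \<Longrightarrow> \<sigma> \<subseteq> \<tau> \<Longrightarrow> cell_lcm gs \<sigma> \<le> cell_lcm gs \<tau>"
  using cell_lcm_le_iff[of \<sigma> gs "cell_lcm gs \<tau>"] le_cell_lcm[of \<tau>] finite_subset[of \<sigma> \<tau>] by blast

lemma cell_lcm_empty [simp]: "cell_lcm gs {} = 0"
  by (simp add: cell_lcm_def lcm_list_def)

lemma admissible_finite: "admissible gs \<sigma> \<Longrightarrow> finite \<sigma>"
  unfolding admissible_def using finite_subset by blast

lemma admissible_empty [simp]: "admissible gs {}"
  by (simp add: admissible_def)

lemma admissible_subset:
  assumes "admissible gs \<tau>" "\<sigma> \<subseteq> \<tau>"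
  shows "admissible gs \<sigma>"
  unfolding admissible_def
proof (intro conjI ballI allI impI notI)
  show "\<sigma> \<subseteq> {..<length gs}" using assms by (auto simp: admissible_def)
  fix q p assume q: "q \<in> \<sigma>" "p < q" "gs ! p \<le> cell_lcm gs (\<sigma> \<inter> {q..})"
  moreover have "cell_lcm gs (\<sigma> \<inter> {q..}) \<le> cell_lcm gs (\<tau> \<inter> {q..})"
    using assms admissible_finite by (intro cell_lcm_mono) auto
  ultimately have "gs ! p \<le> cell_lcm gs (\<tau> \<inter> {q..})" by (meson order_trans)
  then show False using assms q(1,2) by (auto simp: admissible_def)
qed

text \<open>
The apex of the cone formed by the cells whose lcm divides \<open>w\<close>.
\<close>

definition first_divisor :: "'n monomial list \<Rightarrow> 'n monomial \<Rightarrow> nat" where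
  "first_divisor gs w = (LEAST q. q < length gs \<and> gs ! q \<le> w)"

lemma first_divisor:
  assumes "\<exists>q<length gs. gs ! q \<le> w"
  shows "first_divisor gs w < length gs" "gs ! first_divisor gs w \<le> w"
  using LeastI_ex[of "\<lambda>q. q < length gs \<and> gs ! q \<le> w"] assms
  unfolding first_divisor_def by auto

lemma first_divisor_le: "q < length gs \<Longrightarrow> gs ! q \<le> w \<Longrightarrow> first_divisor gs w \<le> q"
  unfolding first_divisor_def by (rule Least_le) simp

text \<open>
Every member of a cell whose lcm divides \<open>w\<close> divides \<open>w\<close> itself, so it comes no earlier than the first
divisor of \<open>w\<close>. Prepending this divisor leaves the tails starting at old members unchanged, and the
only new tail is the whole cell, whose lcm divides \<open>w\<close> and hence has no divisor before the first one.
\<close>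

lemma admissible_insert_first_divisor:
  assumes \<sigma>: "admissible gs \<sigma>" "cell_lcm gs \<sigma> \<le> w" and ex: "\<exists>q<length gs. gs ! q \<le> w"
  shows "admissible gs (insert (first_divisor gs w) \<sigma>)"
    "cell_lcm gs (insert (first_divisor gs w) \<sigma>) \<le> w"
proof -
  let ?q = "first_divisor gs w"
  have fin: "finite \<sigma>" using \<sigma>(1) by (rule admissible_finite)
  have le: "gs ! x \<le> w" if "x \<in> insert ?q \<sigma>" for x
    using that \<sigma>(2) first_divisor(2)[OF ex] cell_lcm_le_iff[OF fin] by auto
  then show "cell_lcm gs (insert ?q \<sigma>) \<le> w"
    using fin by (simp add: cell_lcm_le_iff)
  show "admissible gs (insert ?q \<sigma>)"
    unfolding admissible_def
  proof (intro conjI ballI allI impI notI)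
    show sub: "insert ?q \<sigma> \<subseteq> {..<length gs}"
      using \<sigma>(1) first_divisor(1)[OF ex] by (auto simp: admissible_def)
    fix x p assume x: "x \<in> insert ?q \<sigma>" and p: "p < x"
      and div: "gs ! p \<le> cell_lcm gs (insert ?q \<sigma> \<inter> {x..})"
    show False
    proof (cases "x = ?q")
      case True
      have "cell_lcm gs (insert ?q \<sigma> \<inter> {x..}) \<le> w"
        using fin le by (subst cell_lcm_le_iff) auto
      with div have "gs ! p \<le> w" by (meson order_trans)
      then have "?q \<le> p"
        using p x sub by (intro first_divisor_le) auto
      with p True show False by simp
    next
      case False
      with x have "x \<in> \<sigma>" by simp
      moreover have "?q \<le> x"
        using x sub le by (intro first_divisor_le) auto
      with False have "insert ?q \<sigma> \<inter> {x..} = \<sigma> \<inter> {x..}" by auto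
      ultimately show False using \<sigma>(1) p div by (auto simp: admissible_def)
    qed
  qed
qed

text \<open>
The coefficient of \<open>v\<close> at the cell \<open>\<sigma>\<close> in multidegree \<open>w\<close>. For fixed \<open>w\<close> these coefficients turn the
Lyubeznik complex into the augmented chain complex over the field of the simplicial complex of the
cells whose lcm divides \<open>w\<close>.
\<close>

definition coef :: "'n monomial list \<Rightarrow> ('n::finite, 'k::field) vec \<Rightarrow> nat set \<Rightarrow> 'n monomial \<Rightarrow> 'k" where
  "coef gs v \<sigma> w =
     (if cell_lcm gs \<sigma> \<le> w then Poly_Mapping.lookup (v (set_encode \<sigma>)) (w - cell_lcm gs \<sigma>) else 0)"

lemma lookup_single_mult:
  fixes p :: "('n::finite, 'k::field) poly_ring"
  shows "Poly_Mapping.lookup (Poly_Mapping.single s c * p) t =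
    (if s \<le> t then c * Poly_Mapping.lookup p (t - s) else 0)"
proof -
  have "Poly_Mapping.lookup (Poly_Mapping.single s c * p) t =
      (\<Sum>l. (c * (\<Sum>u. Poly_Mapping.lookup p u when t = l + u)) when s = l)"
    unfolding lookup_mult lookup_single by (simp add: when_mult)
  also have "\<dots> = c * (\<Sum>u. Poly_Mapping.lookup p u when t = s + u)"
    by simp
  also have "(\<Sum>u. Poly_Mapping.lookup p u when t = s + u) =
      (if s \<le> t then Poly_Mapping.lookup p (t - s) else 0)"
  proof (cases "s \<le> t")
    case True
    then have "t = s + u \<longleftrightarrow> t - s = u" for u
      by (auto simp: fun_eq_iff le_fun_def) (metis le_add_diff_inverse)
    with True show ?thesis by simp
  next
    case False
    then have "t \<noteq> s + u" for u by (auto simp: le_fun_def)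
    with False show ?thesis by simp
  qed
  finally show ?thesis by simp
qed

lemma basis_lyubeznik:
  "basis (lyubeznik gs :: ('n::finite, 'k::field) free_cplx) i = set_encode ` {\<sigma>. admissible gs \<sigma> \<and> card \<sigma> = i}"
  by (simp add: lyubeznik_def)

lemma set_encode_in_basis:
  assumes "finite \<sigma>"
  shows "set_encode \<sigma> \<in> basis (lyubeznik gs :: ('n::finite, 'k::field) free_cplx) i \<longleftrightarrow> admissible gs \<sigma> \<and> card \<sigma> = i"
proof
  assume "set_encode \<sigma> \<in> basis (lyubeznik gs :: ('n, 'k) free_cplx) i"
  then obtain \<tau> where "set_encode \<sigma> = set_encode \<tau>" "admissible gs \<tau>" "card \<tau> = i"
    by (auto simp: basis_lyubeznik)
  with assms show "admissible gs \<sigma> \<and> card \<sigma> = i"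
    using set_encode_eq admissible_finite by metis
qed (auto simp: basis_lyubeznik)

lemma finite_admissible: "finite {\<sigma>. admissible gs \<sigma>}"
  by (rule finite_subset[of _ "Pow {..<length gs}"]) (auto simp: admissible_def)

lemma finite_basis_lyubeznik: "finite (basis (lyubeznik gs :: ('n::finite, 'k::field) free_cplx) i)"
  unfolding basis_lyubeznik by (rule finite_imageI, rule finite_subset[OF _ finite_admissible]) auto

lemma coef_eq_0:
  assumes "v \<in> fmod (lyubeznik gs) i" "finite \<sigma>" "\<not> (admissible gs \<sigma> \<and> card \<sigma> = i \<and> cell_lcm gs \<sigma> \<le> w)"
  shows "coef gs v \<sigma> w = 0"
  using assms set_encode_in_basis[OF assms(2), of gs i]
  by (auto simp: coef_def fmod_def)

text \<open>
A vector is determined by its multigraded coefficients.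
\<close>

lemma vec_eqI:
  fixes u v :: "('n::finite, 'k::field) vec"
  assumes "u \<in> fmod (lyubeznik gs) i" "v \<in> fmod (lyubeznik gs) i"
    and eq: "\<And>\<sigma> w. admissible gs \<sigma> \<Longrightarrow> card \<sigma> = i \<Longrightarrow> cell_lcm gs \<sigma> \<le> w \<Longrightarrow> coef gs u \<sigma> w = coef gs v \<sigma> w"
  shows "u = v"
proof (rule ext)
  fix a
  show "u a = v a"
  proof (cases "a \<in> basis (lyubeznik gs :: ('n, 'k) free_cplx) i")
    case True
    then obtain \<sigma> where \<sigma>: "a = set_encode \<sigma>" "admissible gs \<sigma>" "card \<sigma> = i"
      by (auto simp: basis_lyubeznik)
    show ?thesis
    proof (rule poly_mapping_eqI)
      fix t
      have "cell_lcm gs \<sigma> \<le> t + cell_lcm gs \<sigma>" by (simp add: le_fun_def)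
      moreover have "t + cell_lcm gs \<sigma> - cell_lcm gs \<sigma> = t" by (simp add: fun_eq_iff)
      ultimately show "Poly_Mapping.lookup (u a) t = Poly_Mapping.lookup (v a) t"
        using eq[OF \<sigma>(2,3), of "t + cell_lcm gs \<sigma>"] by (simp add: coef_def \<sigma>(1))
    qed
  next
    case False
    with assms(1,2) show ?thesis by (simp add: fmod_def)
  qed
qed

text \<open>
In a fixed multidegree the monomial factors disappear and the boundary is the simplicial one. Sets
that are not cells need no separate treatment, because coefficients vanish there.
\<close>

lemma coef_bmap:
  fixes v :: "('n::finite, 'k::field) vec"
  assumes v: "v \<in> fmod (lyubeznik gs) (Suc i)" and \<sigma>: "finite \<sigma>"
  shows "coef gs (bmap (lyubeznik gs) i v) \<sigma> w =
    (\<Sum>p\<in>{..<length gs} - \<sigma>. face_sign p \<sigma> * coef gs v (insert p \<sigma>) w)"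
proof (cases "admissible gs \<sigma> \<and> card \<sigma> = i \<and> cell_lcm gs \<sigma> \<le> w")
  case False
  have "coef gs v (insert p \<sigma>) w = 0" if "p \<in> {..<length gs} - \<sigma>" for p
  proof (rule coef_eq_0[OF v])
    show "finite (insert p \<sigma>)" using \<sigma> by simp
    show "\<not> (admissible gs (insert p \<sigma>) \<and> card (insert p \<sigma>) = Suc i \<and> cell_lcm gs (insert p \<sigma>) \<le> w)"
      using False that \<sigma> admissible_subset[of gs "insert p \<sigma>" \<sigma>]
        cell_lcm_mono[of "insert p \<sigma>" \<sigma> gs] by (auto dest: order_trans)
  qed
  then show ?thesis
    using coef_eq_0[OF fmod_bmap \<sigma> False] by simp
next
  case True
  let ?L = "lyubeznik gs :: ('n, 'k) free_cplx"
  let ?T = "{\<tau>. admissible gs \<tau> \<and> card \<tau> = Suc i}"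
  let ?P = "{p \<in> {..<length gs} - \<sigma>. admissible gs (insert p \<sigma>)}"
  let ?m = "cell_lcm gs \<sigma>"
  have inj: "inj_on set_encode ?T"
    using inj_on_set_encode admissible_finite by (auto intro: inj_on_subset)
  have "coef gs (bmap ?L i v) \<sigma> w = Poly_Mapping.lookup (\<Sum>b\<in>basis ?L (Suc i). bdry ?L i (set_encode \<sigma>) b * v b) (w - ?m)"
    using True \<sigma> set_encode_in_basis[OF \<sigma>, of gs i, where 'k = 'k] by (simp add: coef_def bmap_def)
  also have "\<dots> = (\<Sum>\<tau>\<in>?T. Poly_Mapping.lookup (bdry ?L i (set_encode \<sigma>) (set_encode \<tau>) * v (set_encode \<tau>)) (w - ?m))"
    unfolding basis_lyubeznik lookup_sum by (subst sum.reindex[OF inj]) simp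
  also have "\<dots> = (\<Sum>\<tau>\<in>(\<lambda>p. insert p \<sigma>) ` ?P. Poly_Mapping.lookup (bdry ?L i (set_encode \<sigma>) (set_encode \<tau>) * v (set_encode \<tau>)) (w - ?m))"
  proof (rule sum.mono_neutral_right)
    show "finite ?T" by (rule finite_subset[OF _ finite_admissible]) auto
    show "(\<lambda>p. insert p \<sigma>) ` ?P \<subseteq> ?T" using True \<sigma> by auto
    show "\<forall>\<tau>\<in>?T - (\<lambda>p. insert p \<sigma>) ` ?P.
        Poly_Mapping.lookup (bdry ?L i (set_encode \<sigma>) (set_encode \<tau>) * v (set_encode \<tau>)) (w - ?m) = 0"
    proof
      fix \<tau> assume \<tau>: "\<tau> \<in> ?T - (\<lambda>p. insert p \<sigma>) ` ?P"
      then have fin: "finite \<tau>" using admissible_finite by blast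
      have "\<not> \<sigma> \<subseteq> \<tau>"
      proof
        assume sub: "\<sigma> \<subseteq> \<tau>"
        then have "card (\<tau> - \<sigma>) = 1"
          using \<tau> True \<sigma> by (simp add: card_Diff_subset)
        then obtain p where p: "\<tau> - \<sigma> = {p}" by (auto simp: card_1_singleton_iff)
        with sub have "\<tau> = insert p \<sigma>" "p \<notin> \<sigma>" by auto
        with \<tau> show False by (auto simp: admissible_def)
      qed
      then have "bdry ?L i (set_encode \<sigma>) (set_encode \<tau>) = 0"
        using \<sigma> fin by (simp add: lyubeznik_def)
      then show "Poly_Mapping.lookup (bdry ?L i (set_encode \<sigma>) (set_encode \<tau>) * v (set_encode \<tau>)) (w - ?m) = 0"
        by simp
    qed
  qed
  also have "\<dots> = (\<Sum>p\<in>?P. Poly_Mapping.lookup (bdry ?L i (set_encode \<sigma>) (set_encode (insert p \<sigma>)) * v (set_encode (insert p \<sigma>))) (w - ?m))"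
    by (subst sum.reindex) (auto simp: inj_on_def)
  also have "\<dots> = (\<Sum>p\<in>?P. face_sign p \<sigma> * coef gs v (insert p \<sigma>) w)"
  proof (rule sum.cong[OF refl])
    fix p assume p: "p \<in> ?P"
    let ?n = "cell_lcm gs (insert p \<sigma>)"
    have "insert p \<sigma> - \<sigma> = {p}" using p by auto
    then have b: "bdry ?L i (set_encode \<sigma>) (set_encode (insert p \<sigma>)) = Poly_Mapping.single (?n - ?m) (face_sign p \<sigma>)"
      using \<sigma> by (simp add: lyubeznik_def subset_insertI)
    have mn: "?m \<le> ?n" using \<sigma> by (intro cell_lcm_mono) auto
    have "?n - ?m \<le> w - ?m \<longleftrightarrow> ?n \<le> w"
      using mn True by (auto simp: le_fun_def) (metis diff_le_mono le_add_diff_inverse2 le_diff_conv)+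
    moreover have "w - ?m - (?n - ?m) = w - ?n"
      using mn by (auto simp: le_fun_def fun_eq_iff)
    ultimately show "Poly_Mapping.lookup (bdry ?L i (set_encode \<sigma>) (set_encode (insert p \<sigma>)) * v (set_encode (insert p \<sigma>))) (w - ?m)
        = face_sign p \<sigma> * coef gs v (insert p \<sigma>) w"
      unfolding b lookup_single_mult by (simp add: coef_def)
  qed
  also have "\<dots> = (\<Sum>p\<in>{..<length gs} - \<sigma>. face_sign p \<sigma> * coef gs v (insert p \<sigma>) w)"
  proof (rule sum.mono_neutral_left)
    have "coef gs v (insert p \<sigma>) w = 0" if "\<not> admissible gs (insert p \<sigma>)" for p
      using coef_eq_0[OF v, of "insert p \<sigma>"] that \<sigma> by simp
    then show "\<forall>p\<in>{..<length gs} - \<sigma> - ?P. face_sign p \<sigma> * coef gs v (insert p \<sigma>) w = 0"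
      by auto
  qed auto
  finally show ?thesis .
qed

lemma face_sign_eq_1:
  assumes "\<And>x. x \<in> \<sigma> \<Longrightarrow> q \<le> x"
  shows "face_sign q \<sigma> = 1"
proof -
  have "{x \<in> \<sigma>. x < q} = {}" using assms by fastforce
  then show ?thesis unfolding face_sign_def by (simp only: card.empty power_0)
qed

lemma face_sign_insert:
  assumes "finite \<sigma>" "p \<notin> \<sigma>"
  shows "face_sign q (insert p \<sigma>) = (if p < q then - face_sign q \<sigma> else face_sign q \<sigma> :: 'k::field)"
proof -
  have "{x \<in> insert p \<sigma>. x < q} = (if p < q then insert p {x \<in> \<sigma>. x < q} else {x \<in> \<sigma>. x < q})"
    by auto
  then show ?thesis using assms by (simp add: face_sign_def)
qed

text \<open>
The terms cancel in pairs. Splitting the double sum by the order of \<open>p\<close> and \<open>q\<close> covers all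
characteristics, including 2.
\<close>

lemma sum_antisymmetric:
  fixes g :: "nat \<Rightarrow> nat \<Rightarrow> 'k::field"
  assumes "finite P" "\<And>p q. p \<in> P \<Longrightarrow> q \<in> P \<Longrightarrow> p < q \<Longrightarrow> g q p = - g p q"
  shows "(\<Sum>p\<in>P. \<Sum>q\<in>P - {p}. g p q) = 0"
proof -
  have "(\<Sum>p\<in>P. \<Sum>q\<in>P - {p}. g p q) = (\<Sum>p\<in>P. (\<Sum>q\<in>{q\<in>P. p < q}. g p q) + (\<Sum>q\<in>{q\<in>P. q < p}. g p q))"
    using assms(1) by (intro sum.cong refl) (subst sum.union_disjoint[symmetric]; auto intro!: sum.cong)
  also have "\<dots> = (\<Sum>p\<in>P. \<Sum>q\<in>{q\<in>P. p < q}. g p q) + (\<Sum>p\<in>P. \<Sum>q\<in>{q\<in>P. q < p}. g p q)"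
    by (rule sum.distrib)
  also have "(\<Sum>p\<in>P. \<Sum>q\<in>{q\<in>P. q < p}. g p q) = (\<Sum>q\<in>P. \<Sum>p\<in>{p\<in>P. q < p}. g p q)"
    by (rule sum.swap_restrict[OF assms(1,1)])
  also have "\<dots> = (\<Sum>q\<in>P. \<Sum>p\<in>{p\<in>P. q < p}. - g q p)"
    using assms(2) by (intro sum.cong) auto
  finally show ?thesis by (simp add: sum_negf)
qed

lemma lyubeznik_bmap_bmap:
  fixes v :: "('n::finite, 'k::field) vec"
  assumes v: "v \<in> fmod (lyubeznik gs) (Suc (Suc i))"
  shows "bmap (lyubeznik gs) i (bmap (lyubeznik gs) (Suc i) v) = 0"
proof (rule vec_eqI[OF fmod_bmap fmod_0])
  fix \<sigma> w assume "admissible gs \<sigma>"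
  then have \<sigma>: "finite \<sigma>" by (rule admissible_finite)
  let ?P = "{..<length gs} - \<sigma>"
  let ?g = "\<lambda>p q. face_sign p \<sigma> * (face_sign q (insert p \<sigma>) * coef gs v (insert q (insert p \<sigma>)) w)"
  have "coef gs (bmap (lyubeznik gs) i (bmap (lyubeznik gs) (Suc i) v)) \<sigma> w = (\<Sum>p\<in>?P. \<Sum>q\<in>?P - {p}. ?g p q)"
    using \<sigma> v by (simp add: coef_bmap sum_distrib_left Diff_insert2[symmetric] Diff_insert[symmetric])
  also have "\<dots> = 0"
  proof (rule sum_antisymmetric)
    fix p q assume "p \<in> ?P" "q \<in> ?P" "p < q"
    then show "?g q p = - ?g p q"
      using \<sigma> by (simp add: face_sign_insert insert_commute)
  qed simp
  finally show "coef gs (bmap (lyubeznik gs) i (bmap (lyubeznik gs) (Suc i) v)) \<sigma> w = coef gs 0 \<sigma> w"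
    by (simp add: coef_def)
qed

lemma amap_lyubeznik: "amap (lyubeznik gs :: ('n::finite, 'k::field) free_cplx) v = v (set_encode {})"
proof -
  have "{\<sigma>. admissible gs \<sigma> \<and> card \<sigma> = 0} = {{}}"
    using admissible_finite by fastforce
  then have "basis (lyubeznik gs :: ('n, 'k) free_cplx) 0 = {set_encode {}}"
    by (simp add: basis_lyubeznik)
  then show ?thesis by (simp add: amap_def) (simp add: lyubeznik_def)
qed

text \<open>
The cone contraction, which sends a cell \<open>\<sigma>\<close> in multidegree \<open>w\<close> to the cell with the first divisor of
\<open>w\<close> inserted and to 0 if \<open>\<sigma>\<close> contains that divisor, written on coefficients. It is linear over the field but not over \<open>S\<close>, so it is described
coefficient by coefficient; for each cell only finitely many multidegrees contribute.
\<close>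

lemma contraction_exists:
  fixes v :: "('n::finite, 'k::field) vec"
  assumes v: "v \<in> fmod (lyubeznik gs) i"
  obtains u where "u \<in> fmod (lyubeznik gs) (Suc i)"
    "\<And>\<tau> w. admissible gs \<tau> \<Longrightarrow> card \<tau> = Suc i \<Longrightarrow> cell_lcm gs \<tau> \<le> w \<Longrightarrow>
       coef gs u \<tau> w = (if first_divisor gs w \<in> \<tau> then coef gs v (\<tau> - {first_divisor gs w}) w else 0)"
proof -
  let ?L = "lyubeznik gs :: ('n, 'k) free_cplx"
  define c where "c \<tau> w = (if first_divisor gs w \<in> \<tau> then coef gs v (\<tau> - {first_divisor gs w}) w else 0)" for \<tau> w
  define u where "u a = (if a \<in> basis ?L (Suc i)
      then Poly_Mapping.Abs_poly_mapping (\<lambda>t. c (set_decode a) (t + cell_lcm gs (set_decode a))) else 0)" for a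
  have fin: "finite {t. c \<tau> (t + cell_lcm gs \<tau>) \<noteq> 0}" if \<tau>: "finite \<tau>" for \<tau>
  proof (rule finite_subset)
    let ?K = "\<Union>q\<in>\<tau>. (\<lambda>s. s + cell_lcm gs (\<tau> - {q}) - cell_lcm gs \<tau>) ` Poly_Mapping.keys (v (set_encode (\<tau> - {q})))"
    show "finite ?K" using \<tau> by simp
    show "{t. c \<tau> (t + cell_lcm gs \<tau>) \<noteq> 0} \<subseteq> ?K"
    proof
      fix t assume "t \<in> {t. c \<tau> (t + cell_lcm gs \<tau>) \<noteq> 0}"
      then obtain q where q: "q \<in> \<tau>" "coef gs v (\<tau> - {q}) (t + cell_lcm gs \<tau>) \<noteq> 0"
        by (auto simp: c_def split: if_splits)
      then have le: "cell_lcm gs (\<tau> - {q}) \<le> t + cell_lcm gs \<tau>"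
        and key: "t + cell_lcm gs \<tau> - cell_lcm gs (\<tau> - {q}) \<in> Poly_Mapping.keys (v (set_encode (\<tau> - {q})))"
        by (auto simp: coef_def in_keys_iff split: if_splits)
      have "t = (t + cell_lcm gs \<tau> - cell_lcm gs (\<tau> - {q})) + cell_lcm gs (\<tau> - {q}) - cell_lcm gs \<tau>"
        using le by (auto simp: fun_eq_iff le_fun_def)
      with q(1) key show "t \<in> ?K" by blast
    qed
  qed
  show ?thesis
  proof
    show "u \<in> fmod ?L (Suc i)" by (simp add: fmod_def u_def)
    fix \<tau> w assume \<tau>: "admissible gs \<tau>" "card \<tau> = Suc i" "cell_lcm gs \<tau> \<le> w"
    have f: "finite \<tau>" using \<tau>(1) by (rule admissible_finite)
    have "w - cell_lcm gs \<tau> + cell_lcm gs \<tau> = w"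
      using \<tau>(3) by (auto simp: fun_eq_iff le_fun_def)
    then show "coef gs u \<tau> w = (if first_divisor gs w \<in> \<tau> then coef gs v (\<tau> - {first_divisor gs w}) w else 0)"
      using \<tau> f set_encode_in_basis[OF f, of gs "Suc i", where 'k = 'k] fin[OF f]
      by (simp add: coef_def[of gs u] u_def) (simp add: c_def)
  qed
qed

text \<open>
The cone contraction \<open>u\<close> of a cycle \<open>v\<close> has boundary \<open>v\<close>, as is checked in each multidegree \<open>w\<close>. At a
cell without the apex, only the term that inserts the apex survives. At a cell \<open>\<sigma>\<close> with apex \<open>q\<close>, the
terms are those of the boundary of \<open>v\<close> at \<open>\<sigma> - {q}\<close>, apart from \<open>v\<close> at \<open>\<sigma>\<close> itself. If no generator
divides \<open>w\<close>, then the only cell is the empty one, and membership in the ideal makes \<open>v\<close> vanish there.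
\<close>

lemma lyubeznik_exact:
  fixes v :: "('n::finite, 'k::field) vec"
  assumes cyc: "cycle (monomial_ideal (set gs)) (lyubeznik gs) i v"
  shows "v \<in> bmap (lyubeznik gs) i ` fmod (lyubeznik gs) (Suc i)"
proof -
  let ?L = "lyubeznik gs :: ('n, 'k) free_cplx"
  have v: "v \<in> fmod ?L i" using cyc by (simp add: cycle_def)
  obtain u where u: "u \<in> fmod ?L (Suc i)"
    and cu: "\<And>\<tau> w. admissible gs \<tau> \<Longrightarrow> card \<tau> = Suc i \<Longrightarrow> cell_lcm gs \<tau> \<le> w \<Longrightarrow>
       coef gs u \<tau> w = (if first_divisor gs w \<in> \<tau> then coef gs v (\<tau> - {first_divisor gs w}) w else 0)"
    using contraction_exists[OF v] by blast
  have "bmap ?L i u = v"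
  proof (rule vec_eqI[OF fmod_bmap v])
    fix \<sigma> w assume adm: "admissible gs \<sigma>" and card: "card \<sigma> = i" and le: "cell_lcm gs \<sigma> \<le> w"
    have fin: "finite \<sigma>" using adm by (rule admissible_finite)
    have sub: "\<sigma> \<subseteq> {..<length gs}" using adm by (simp add: admissible_def)
    have le': "gs ! x \<le> w" if "x \<in> \<sigma>" for x using le that cell_lcm_le_iff[OF fin] by auto
    have "coef gs (bmap ?L i u) \<sigma> w = (\<Sum>p\<in>{..<length gs} - \<sigma>. face_sign p \<sigma> * coef gs u (insert p \<sigma>) w)"
      by (rule coef_bmap[OF u fin])
    also have "\<dots> = coef gs v \<sigma> w"
    proof (cases "\<exists>q<length gs. gs ! q \<le> w")
      case False
      then have "\<sigma> = {}" using le' sub by auto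
      then have "i = 0" using card by simp
      then have "v (set_encode {}) \<in> monomial_ideal (set gs)" using cyc by (simp add: cycle_0 amap_lyubeznik)
      then have "w \<notin> Poly_Mapping.keys (v (set_encode {}))" using False by (auto simp: mem_monomial_ideal_set)
      then have "coef gs v \<sigma> w = 0"
        by (simp add: \<open>\<sigma> = {}\<close> coef_def in_keys_iff)
      moreover have "coef gs u (insert p \<sigma>) w = 0" if "p < length gs" for p
        using False that fin cell_lcm_le_iff[of "insert p \<sigma>" gs w] by (intro coef_eq_0[OF u]) auto
      ultimately show ?thesis by simp
    next
      case True
      define q where "q = first_divisor gs w"
      have q: "q < length gs" "gs ! q \<le> w" using first_divisor[OF True] by (simp_all add: q_def)
      have q_le: "q \<le> p" if "p < length gs" "gs ! p \<le> w" for p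
        using first_divisor_le that by (simp add: q_def)
      have q_min: "q \<le> x" if "x \<in> \<sigma>" for x using that sub le' q_le by auto
      have insq: "admissible gs (insert q \<rho>)" "cell_lcm gs (insert q \<rho>) \<le> w"
        if "admissible gs \<rho>" "cell_lcm gs \<rho> \<le> w" for \<rho>
        using admissible_insert_first_divisor[OF that True] by (simp_all add: q_def)
      show ?thesis
      proof (cases "q \<in> \<sigma>")
        case False
        have "coef gs u (insert p \<sigma>) w = 0" if "p \<noteq> q" "p \<notin> \<sigma>" for p
        proof (cases "admissible gs (insert p \<sigma>) \<and> card (insert p \<sigma>) = Suc i \<and> cell_lcm gs (insert p \<sigma>) \<le> w")
          case True
          with that False show ?thesis by (simp add: cu q_def[symmetric])
        next
          case False
          with fin show ?thesis by (intro coef_eq_0[OF u]) auto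
        qed
        then have "(\<Sum>p\<in>{..<length gs} - \<sigma>. face_sign p \<sigma> * coef gs u (insert p \<sigma>) w)
            = (\<Sum>p\<in>{q}. face_sign p \<sigma> * coef gs u (insert p \<sigma>) w)"
          using q(1) False by (intro sum.mono_neutral_right) auto
        also have "coef gs u (insert q \<sigma>) w = coef gs v \<sigma> w"
          using cu[OF insq(1)[OF adm le] _ insq(2)[OF adm le]] fin False card
          by (simp add: q_def[symmetric])
        then have "(\<Sum>p\<in>{q}. face_sign p \<sigma> * coef gs u (insert p \<sigma>) w) = face_sign q \<sigma> * coef gs v \<sigma> w"
          by simp
        also have "face_sign q \<sigma> = (1 :: 'k)" using q_min by (rule face_sign_eq_1)
        finally show ?thesis by simp
      next
        case True
        define \<rho> where "\<rho> = \<sigma> - {q}"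
        have \<rho>: "finite \<rho>" "q \<notin> \<rho>" "\<sigma> = insert q \<rho>" using fin True by (auto simp: \<rho>_def)
        then obtain j where j: "i = Suc j" "card \<rho> = j" using card by auto
        \<comment> \<open>Passing from \<open>\<rho>\<close> to \<open>\<sigma>\<close> inserts the apex in front, which flips the sign of every face that a later generator defines.\<close>
        have term_eq: "face_sign p \<sigma> * coef gs u (insert p \<sigma>) w = - (face_sign p \<rho> * coef gs v (insert p \<rho>) w)"
          if p: "p \<in> {..<length gs} - \<sigma>" for p
        proof (cases "admissible gs (insert p \<rho>) \<and> card (insert p \<rho>) = i \<and> cell_lcm gs (insert p \<rho>) \<le> w")
          case True
          then have "gs ! p \<le> w" using \<rho>(1) cell_lcm_le_iff[of "insert p \<rho>" gs w] by auto
          then have "q < p" using q_le[of p] p \<rho>(3) by (cases "p = q") auto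
          then have sign: "face_sign p \<sigma> = - (face_sign p \<rho> :: 'k)"
            using \<rho> by (simp add: face_sign_insert)
          have ins: "insert p \<sigma> = insert q (insert p \<rho>)" using \<rho>(3) by auto
          have "insert p \<sigma> - {q} = insert p \<rho>" using p \<rho> by auto
          moreover have "coef gs u (insert p \<sigma>) w = coef gs v (insert p \<sigma> - {q}) w"
          proof -
            have "admissible gs (insert p \<sigma>)" "cell_lcm gs (insert p \<sigma>) \<le> w"
              unfolding ins using insq[of "insert p \<rho>"] True by auto
            moreover have "card (insert p \<sigma>) = Suc i" using p fin card by simp
            ultimately show ?thesis
              using cu[of "insert p \<sigma>" w] \<rho>(3) by (simp add: q_def[symmetric])
          qed
          ultimately show ?thesis by (simp add: sign)
        next
          case False
          have "\<not> (admissible gs (insert p \<sigma>) \<and> card (insert p \<sigma>) = Suc i \<and> cell_lcm gs (insert p \<sigma>) \<le> w)"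
          proof
            assume *: "admissible gs (insert p \<sigma>) \<and> card (insert p \<sigma>) = Suc i \<and> cell_lcm gs (insert p \<sigma>) \<le> w"
            have s: "insert p \<rho> \<subseteq> insert p \<sigma>" using \<rho>(3) by auto
            have "cell_lcm gs (insert p \<rho>) \<le> w"
              using * cell_lcm_mono[OF _ s, of gs] fin by (auto dest: order_trans)
            moreover have "card (insert p \<rho>) = i" using p \<rho> j by simp
            ultimately show False using False * admissible_subset[OF _ s] by blast
          qed
          then have "coef gs u (insert p \<sigma>) w = 0" using fin by (intro coef_eq_0[OF u]) auto
          moreover have "coef gs v (insert p \<rho>) w = 0" using False \<rho>(1) by (intro coef_eq_0[OF v]) auto
          ultimately show ?thesis by simp
        qed
        have bv: "bmap ?L j v = 0" using cyc j(1) by (simp add: cycle_Suc)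
        have "0 = coef gs (bmap ?L j v) \<rho> w" unfolding bv by (simp add: coef_def)
        also have "\<dots> = (\<Sum>p\<in>{..<length gs} - \<rho>. face_sign p \<rho> * coef gs v (insert p \<rho>) w)"
          using v j \<rho> by (intro coef_bmap) auto
        also have "{..<length gs} - \<rho> = insert q ({..<length gs} - \<sigma>)" using q(1) \<rho> by auto
        also have "(\<Sum>p\<in>insert q ({..<length gs} - \<sigma>). face_sign p \<rho> * coef gs v (insert p \<rho>) w)
            = face_sign q \<rho> * coef gs v \<sigma> w + (\<Sum>p\<in>{..<length gs} - \<sigma>. face_sign p \<rho> * coef gs v (insert p \<rho>) w)"
          using True \<rho>(3) by (subst sum.insert) auto
        also have "face_sign q \<rho> = (1 :: 'k)" using q_min \<rho>(3) by (intro face_sign_eq_1) auto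
        finally have "coef gs v \<sigma> w = - (\<Sum>p\<in>{..<length gs} - \<sigma>. face_sign p \<rho> * coef gs v (insert p \<rho>) w)"
          by (simp add: eq_neg_iff_add_eq_0)
        then show ?thesis by (simp add: term_eq sum_negf)
      qed
    qed
    finally show "coef gs (bmap ?L i u) \<sigma> w = coef gs v \<sigma> w" .
  qed
  with u show ?thesis by blast
qed

lemma lyubeznik_resolution:
  "graded_free_resolution (monomial_ideal (set gs)) (lyubeznik gs :: ('n::finite, 'k::field) free_cplx)"
proof -
  let ?I = "monomial_ideal (set gs) :: ('n, 'k) poly_ring set"
  let ?L = "lyubeznik gs :: ('n, 'k) free_cplx"
  have aug: "homogeneous 0 (bdeg ?L 0 a) (aug ?L a)" if "a \<in> basis ?L 0" for a
  proof -
    have "a = set_encode {}"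
      using that by (auto simp: basis_lyubeznik dest!: admissible_finite)
    then show ?thesis by (simp add: lyubeznik_def homogeneous_def)
  qed
  have bdry: "homogeneous (bdeg ?L i a) (bdeg ?L (Suc i) b) (bdry ?L i a b)" for i a b
  proof -
    let ?m = "cell_lcm gs (set_decode a)" and ?n = "cell_lcm gs (set_decode b)"
    have "mdegree (?n - ?m) + mdegree ?m = mdegree ?n" if "set_decode a \<subseteq> set_decode b"
    proof -
      have "?m \<le> ?n" using that by (intro cell_lcm_mono) auto
      then have "?n - ?m + ?m = ?n" by (auto simp: fun_eq_iff le_fun_def)
      then show ?thesis by (metis mdegree_add)
    qed
    then show ?thesis
      by (auto simp: lyubeznik_def homogeneous_def Let_def split: if_splits)
  qed
  have surj: "\<exists>v\<in>fmod ?L 0. p - amap ?L v \<in> ?I" for p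
  proof
    show "(\<lambda>a. if a = set_encode {} then p else 0) \<in> fmod ?L 0"
      using set_encode_in_basis[of "{}" gs 0] by (auto simp: fmod_def)
    show "p - amap ?L (\<lambda>a. if a = set_encode {} then p else 0) \<in> ?I"
      by (simp add: amap_lyubeznik mem_monomial_ideal_set)
  qed
  have image: "cycle ?I ?L i (bmap ?L i v)" if v: "v \<in> fmod ?L (Suc i)" for i v
  proof (cases i)
    case 0
    have "\<exists>q<length gs. gs ! q \<le> t" if "t \<in> Poly_Mapping.keys (bmap ?L 0 v (set_encode {}))" for t
    proof -
      have "coef gs (bmap ?L 0 v) {} t \<noteq> 0"
        using that by (simp add: coef_def in_keys_iff le_fun_def)
      then obtain p where "p < length gs" "coef gs v {p} t \<noteq> 0"
        using coef_bmap[of v gs 0 "{}" t] v 0 by (auto elim: sum.not_neutral_contains_not_neutral)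
      then show ?thesis
        using cell_lcm_le_iff[of "{p}" gs t] by (auto simp: coef_def split: if_splits)
    qed
    then show ?thesis by (simp add: 0 cycle_0 amap_lyubeznik mem_monomial_ideal_set)
  next
    case (Suc j)
    then show ?thesis using lyubeznik_bmap_bmap v by (simp add: cycle_Suc)
  qed
  show ?thesis
    unfolding graded_free_resolution_def
  proof (intro conjI allI ballI)
    show "bmap ?L 0 ` fmod ?L 1 = {v \<in> fmod ?L 0. amap ?L v \<in> ?I}"
      using image[of _ 0] lyubeznik_exact[of gs 0] by (auto simp: cycle_0)
    show "bmap ?L (Suc i) ` fmod ?L (Suc (Suc i)) = {v \<in> fmod ?L (Suc i). bmap ?L i v = 0}" for i
      using image[of _ "Suc i"] lyubeznik_exact[of gs "Suc i"] by (auto simp: cycle_Suc)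
  qed (use aug bdry surj finite_basis_lyubeznik in auto)
qed

lemma finite_total_basis_lyubeznik:
  "finite (total_basis (lyubeznik gs :: ('n::finite, 'k::field) free_cplx))"
proof (rule finite_subset)
  show "finite ((\<lambda>\<sigma>. (card \<sigma>, set_encode \<sigma>)) ` {\<sigma>. admissible gs \<sigma>})"
    using finite_admissible by (rule finite_imageI)
qed (auto simp: total_basis_def basis_lyubeznik)

section \<open>Degrees in the minimal resolution of a monomial ideal\<close>

text \<open>
The Betti numbers are defined by a choice of minimal resolution; this is where existence of such a
resolution gives them their meaning.
\<close>

lemma max_shift_resolution:
  fixes I :: "('n::finite, 'k::field) poly_ring set"
  assumes "squarefree_monomial_ideal I" "finite (min_gens I)"
  obtains F :: "('n, 'k) free_cplx" where "minimal_graded_free_resolution I F"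
    "\<And>i. max_shift I i = Max (bdeg F i ` basis F i)"
proof -
  obtain gs where gs: "set gs = min_gens I" using assms(2) finite_list by blast
  have I: "I = monomial_ideal (set gs)"
    using squarefree_monomial_ideal_min_gens(1)[OF assms(1)] gs by simp
  define F where "F = (SOME F :: ('n, 'k) free_cplx. minimal_graded_free_resolution I F)"
  have "\<exists>F :: ('n, 'k) free_cplx. minimal_graded_free_resolution I F"
    unfolding I
    by (rule minimal_resolution_exists[OF subspace_monomial_ideal lyubeznik_resolution
          finite_total_basis_lyubeznik])
  then have F: "minimal_graded_free_resolution I F"
    unfolding F_def by (rule someI_ex)
  have "{j. graded_betti I i j \<noteq> 0} = bdeg F i ` basis F i" for i
  proof -
    have "finite (basis F i)"
      using F by (auto simp: minimal_graded_free_resolution_def intro: resolution_finite)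
    then show ?thesis
      by (auto simp: graded_betti_def F_def[symmetric] Let_def)
  qed
  with F show ?thesis using that by (auto simp: max_shift_def)
qed

text \<open>
No member divides the lcm of the others. For covers this is minimality
(\<open>minimal_cover_irredundant\<close>).
\<close>

definition irredundant :: "'n monomial list \<Rightarrow> bool" where
  "irredundant xs \<longleftrightarrow> distinct xs \<and> (\<forall>x\<in>set xs. \<not> x \<le> lcm_list (remove1 x xs))"

lemma irredundant_not_le:
  assumes "irredundant xs" "x \<in> set xs" "set zs \<subseteq> set xs - {x}"
  shows "\<not> x \<le> lcm_list zs"
proof
  assume "x \<le> lcm_list zs"
  also have "lcm_list zs \<le> lcm_list (remove1 x xs)"
    using assms by (intro lcm_list_mono) (simp add: irredundant_def)
  finally show False using assms by (simp add: irredundant_def)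
qed

lemma irredundant_sublist:
  assumes "irredundant xs" "distinct zs" "set zs \<subseteq> set xs"
  shows "irredundant zs"
  unfolding irredundant_def
proof (intro conjI ballI)
  fix x assume "x \<in> set zs"
  then show "\<not> x \<le> lcm_list (remove1 x zs)"
    using assms by (intro irredundant_not_le[OF assms(1)]) auto
qed fact

text \<open>
The cell consisting of the \<open>xs\<close>, placed first in the order of the generators, is admissible by
irredundancy, and deleting a member lowers its lcm, so its column has no unit. A unit in its row would
come from a cell with one more member \<open>n\<close> and the same lcm. Then \<open>n\<close> divides \<open>lcm_list xs\<close>, and the
divisibility supplied by the last hypothesis contradicts admissibility of that larger cell.
\<close>

lemma lcm_degree_occurs_in_every_resolution:
  fixes F :: "('n::finite, 'k::field) free_cplx"
  assumes F: "graded_free_resolution (monomial_ideal (set (xs @ ys))) F"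
    and irr: "irredundant xs"
    and wo: "\<And>n. n \<in> set ys \<Longrightarrow> n \<le> lcm_list xs \<Longrightarrow> \<exists>j\<in>{1..length xs - 1}. divides_tail xs n j"
  shows "\<exists>b\<in>basis F (length xs). bdeg F (length xs) b = mdegree (lcm_list xs)"
proof -
  let ?gs = "xs @ ys"
  let ?L = "lyubeznik ?gs :: ('n, 'k) free_cplx"
  let ?A = "{..<length xs}"
  have dist: "distinct xs" using irr by (simp add: irredundant_def)
  have lcmA: "cell_lcm ?gs ?A = lcm_list xs"
  proof (rule antisym)
    show "cell_lcm ?gs ?A \<le> lcm_list xs"
      by (simp add: cell_lcm_le_iff nth_append le_lcm_list)
    show "lcm_list xs \<le> cell_lcm ?gs ?A"
      unfolding lcm_list_le_iff
    proof
      fix x assume "x \<in> set xs"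
      then obtain q where "q < length xs" "x = xs ! q" by (auto simp: in_set_conv_nth)
      then show "x \<le> cell_lcm ?gs ?A"
        using le_cell_lcm[of ?A q ?gs] by (simp add: nth_append)
    qed
  qed
  have not_le: "\<not> xs ! q \<le> cell_lcm ?gs \<sigma>" if q: "q < length xs" and \<sigma>: "\<sigma> \<subseteq> ?A - {q}" for q \<sigma>
  proof
    assume "xs ! q \<le> cell_lcm ?gs \<sigma>"
    also have "cell_lcm ?gs \<sigma> = lcm_list (map ((!) ?gs) (sorted_list_of_set \<sigma>))"
      by (simp add: cell_lcm_def)
    finally have "xs ! q \<le> \<dots>" .
    moreover have "finite \<sigma>" using \<sigma> finite_subset by blast
    then have "set (map ((!) ?gs) (sorted_list_of_set \<sigma>)) \<subseteq> set xs - {xs ! q}"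
      using \<sigma> q dist by (auto simp: nth_append nth_eq_iff_index_eq)
    ultimately show False using irredundant_not_le[OF irr] q by (meson nth_mem)
  qed
  have adm: "admissible ?gs ?A"
    unfolding admissible_def
  proof (intro conjI ballI allI impI)
    fix q p assume "q \<in> ?A" "p < q"
    moreover from this have "?A \<inter> {q..} \<subseteq> ?A - {p}" by auto
    ultimately show "\<not> ?gs ! p \<le> cell_lcm ?gs (?A \<inter> {q..})"
      using not_le[of p "?A \<inter> {q..}"] by (simp add: nth_append)
  qed auto
  have a: "set_encode ?A \<in> basis ?L (length xs)"
    using adm by (simp add: set_encode_in_basis)
  have "\<exists>b\<in>basis F (length xs). bdeg F (length xs) b = bdeg ?L (length xs) (set_encode ?A)"
  proof (rule degree_occurs_in_every_resolution[OF homogeneous_monomial_ideal lyubeznik_resolution F a])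
    fix b assume "b \<in> basis ?L (Suc (length xs))"
    then obtain \<tau> where \<tau>: "b = set_encode \<tau>" "admissible ?gs \<tau>" "card \<tau> = Suc (length xs)"
      by (auto simp: basis_lyubeznik)
    have fin: "finite \<tau>" using \<tau>(2) by (rule admissible_finite)
    have "\<not> cell_lcm ?gs \<tau> \<le> lcm_list xs" if sub: "?A \<subseteq> \<tau>"
    proof
      assume le: "cell_lcm ?gs \<tau> \<le> lcm_list xs"
      have "\<not> \<tau> \<subseteq> ?A" using card_mono[of ?A \<tau>] \<tau>(3) by auto
      then obtain q where q: "q \<in> \<tau>" "length xs \<le> q" by (meson lessThan_iff not_less subsetI)
      moreover have "q < length ?gs" using \<tau>(2) q(1) by (auto simp: admissible_def)
      ultimately have n: "?gs ! q \<in> set ys" by (auto simp: nth_append)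
      have "?gs ! q \<le> lcm_list xs" using le_cell_lcm[OF fin q(1), of ?gs] le by (rule order_trans)
      then obtain j where j: "j \<in> {1..length xs - 1}" "xs ! (j - 1) \<le> lcm_list (?gs ! q # drop j xs)"
        using wo[OF n] by (auto simp: divides_tail_def)
      \<comment> \<open>The 0-based positions \<open>j, \<dots>, length xs - 1\<close> and \<open>q\<close> lie in \<open>\<tau>\<close>, so \<open>xs ! (j - 1)\<close> divides the lcm of a tail that it precedes.\<close>
      have "x \<le> cell_lcm ?gs (\<tau> \<inter> {j..})" if "x \<in> set (?gs ! q # drop j xs)" for x
      proof -
        have "\<exists>k\<in>\<tau> \<inter> {j..}. x = ?gs ! k"
        proof (cases "x = ?gs ! q")
          case True
          with q j show ?thesis by (intro bexI[of _ q]) auto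
        next
          case False
          with that obtain k where "k < length xs - j" "x = xs ! (j + k)"
            by (auto simp: in_set_conv_nth)
          with sub show ?thesis by (intro bexI[of _ "j + k"]) (auto simp: nth_append)
        qed
        then show ?thesis using le_cell_lcm[of "\<tau> \<inter> {j..}"] fin by auto
      qed
      then have "xs ! (j - 1) \<le> cell_lcm ?gs (\<tau> \<inter> {j..})"
        using j(2) lcm_list_le_iff by (meson order_trans)
      moreover have "xs ! (j - 1) = ?gs ! (j - 1)" using j(1) by (auto simp: nth_append)
      moreover have "j \<in> \<tau>" "j - 1 < j" using j(1) sub by auto
      ultimately show False using \<tau>(2) by (auto simp: admissible_def)
    qed
    then have "cell_lcm ?gs \<tau> - cell_lcm ?gs ?A \<noteq> 0" if "?A \<subseteq> \<tau>"
      using that by (simp add: lcmA monomial_diff_eq_0_iff)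
    then show "Poly_Mapping.lookup (bdry ?L (length xs) (set_encode ?A) b) 0 = 0"
      using fin by (simp add: \<tau>(1) lyubeznik_def lookup_single Let_def)
  next
    fix j c assume j: "length xs = Suc j" and "c \<in> basis ?L j"
    then obtain \<sigma> where \<sigma>: "c = set_encode \<sigma>" "admissible ?gs \<sigma>" "card \<sigma> = j"
      by (auto simp: basis_lyubeznik)
    have fin: "finite \<sigma>" using \<sigma>(2) by (rule admissible_finite)
    have "cell_lcm ?gs ?A - cell_lcm ?gs \<sigma> \<noteq> 0" if "\<sigma> \<subseteq> ?A"
    proof
      assume "cell_lcm ?gs ?A - cell_lcm ?gs \<sigma> = 0"
      then have le: "cell_lcm ?gs ?A \<le> cell_lcm ?gs \<sigma>" by (simp only: monomial_diff_eq_0_iff)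
      have "card ?A = Suc j" using j by simp
      then have "\<sigma> \<noteq> ?A" using \<sigma>(3) by (metis n_not_Suc_n)
      with that have "\<sigma> \<subset> ?A" by (rule psubsetI)
      from psubset_imp_ex_mem[OF this] obtain q where q: "q < length xs" "q \<notin> \<sigma>" by auto
      have "xs ! q \<le> cell_lcm ?gs ?A" using le_cell_lcm[of ?A q ?gs] q(1) by (simp add: nth_append)
      then have "xs ! q \<le> cell_lcm ?gs \<sigma>" using le by (rule order_trans)
      moreover have "\<sigma> \<subseteq> ?A - {q}" using that q(2) by (simp add: subset_Diff_insert)
      ultimately show False using not_le[OF q(1)] by simp
    qed
    then show "Poly_Mapping.lookup (bdry ?L j c (set_encode ?A)) 0 = 0"
      using fin by (simp add: \<sigma>(1) lyubeznik_def lookup_single Let_def)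
  qed
  then show ?thesis by (simp add: lyubeznik_def lcmA)
qed

text \<open>
Every degree of a minimal resolution occurs in the Lyubeznik resolution in the same position, and
there it is the degree of an lcm of generators.
\<close>

lemma minimal_resolution_degree_le:
  fixes F :: "('n::finite, 'k::field) free_cplx"
  assumes F: "minimal_graded_free_resolution (monomial_ideal (set gs)) F" and b: "b \<in> basis F i"
  shows "bdeg F i b \<le> mdegree (lcm_list gs)"
proof -
  let ?L = "lyubeznik gs :: ('n, 'k) free_cplx"
  have res: "graded_free_resolution (monomial_ideal (set gs)) F"
    and min: "\<And>i a b. a \<in> basis F i \<Longrightarrow> b \<in> basis F (Suc i) \<Longrightarrow> Poly_Mapping.lookup (bdry F i a b) 0 = 0"
    using F by (simp_all add: minimal_graded_free_resolution_def)
  obtain c where c: "c \<in> basis ?L i" "bdeg ?L i c = bdeg F i b"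
    using degree_occurs_in_every_resolution[OF homogeneous_monomial_ideal res lyubeznik_resolution b] min b by blast
  then obtain \<sigma> where \<sigma>: "c = set_encode \<sigma>" "admissible gs \<sigma>" by (auto simp: basis_lyubeznik)
  then have "cell_lcm gs \<sigma> \<le> lcm_list gs"
    using admissible_finite[OF \<sigma>(2)] by (subst cell_lcm_le_iff) (auto simp: admissible_def intro!: le_lcm_list nth_mem)
  then have "bdeg ?L i c \<le> mdegree (lcm_list gs)"
    using \<sigma>(1) admissible_finite[OF \<sigma>(2)] by (simp add: lyubeznik_def mdegree_mono)
  with c(2) show ?thesis by simp
qed

section \<open>Well ordered covers\<close>

text \<open>
If \<open>x\<close> divides the lcm of the others, then they cover the variables of \<open>x\<close>, and \<open>x\<close> can be dropped.
\<close>

lemma minimal_cover_irredundant: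
  assumes "distinct ms" "is_minimal_cover I (set ms)"
  shows "irredundant ms"
  unfolding irredundant_def
proof (intro conjI ballI notI)
  fix x assume x: "x \<in> set ms" and le: "x \<le> lcm_list (remove1 x ms)"
  have cov: "is_cover I (set ms)" using assms(2) by (simp add: is_minimal_cover_def)
  have "is_cover I (set ms - {x})"
    unfolding is_cover_def
  proof (intro conjI allI impI)
    show "set ms - {x} \<subseteq> min_gens I" using cov by (auto simp: is_cover_def)
    fix v assume "\<exists>g\<in>min_gens I. 0 < g v"
    then obtain a where a: "a \<in> set ms" "0 < a v" using cov by (auto simp: is_cover_def)
    show "\<exists>a\<in>set ms - {x}. 0 < a v"
    proof (cases "a = x")
      case True
      then have "0 < x v" "x v \<le> lcm_list (remove1 x ms) v" using a(2) le by (simp_all add: le_fun_def)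
      then have "0 < lcm_list (remove1 x ms) v" by (rule less_le_trans)
      from lcm_list_pos[OF this] obtain z where "z \<in> set (remove1 x ms)" "0 < z v" by blast
      then show ?thesis using assms(1) by auto
    qed (use a in auto)
  qed
  moreover have "set ms - {x} \<subset> set ms" using x by auto
  ultimately show False using assms(2) by (simp add: is_minimal_cover_def)
qed fact

text \<open>
The set whose maximum defines \<open>\<alpha>\<close> is nonempty for a well ordered cover. The value \<open>length ms\<close> is excluded
because the corresponding tail is just \<open>n\<close>, and no other generator divides the minimal generator \<open>n\<close>.
\<close>

lemma alpha_divides_tail:
  assumes "well_ordered_cover I ms" "n \<in> min_gens I - set ms"
  shows "divides_tail ms n (alpha ms n)" "alpha ms n < length ms"
proof -
  let ?J = "{j \<in> {1..length ms}. divides_tail ms n j}"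
  obtain j0 where j0: "j0 \<in> {1..length ms - 1}" "divides_tail ms n j0"
    using assms unfolding well_ordered_cover_def by blast
  then have "j0 \<in> ?J" by auto
  then have mem: "alpha ms n \<in> ?J"
    unfolding alpha_def by (intro Max_in) auto
  then show tail: "divides_tail ms n (alpha ms n)" by simp
  have "alpha ms n \<noteq> length ms"
  proof
    assume "alpha ms n = length ms"
    then have le: "ms ! (length ms - 1) \<le> n"
      using tail by (simp add: divides_tail_def lcm_list_def le_fun_def sup_max)
    have "ms ! (length ms - 1) \<in> set ms" using j0(1) by (intro nth_mem) auto
    moreover have "set ms \<subseteq> min_gens I"
      using assms(1) by (simp add: well_ordered_cover_def is_minimal_cover_def is_cover_def)
    ultimately show False using le assms(2) by (auto simp: min_gens_def)
  qed
  with mem show "alpha ms n < length ms" by auto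
qed

text \<open>
The element at position \<open>\<alpha>(n)\<close> moves to position \<open>\<alpha>(n) - i + 1\<close>, and the new tail after it contains the
old one.
\<close>

lemma well_ordered_cover_rotate:
  assumes wo: "well_ordered_cover I ms" and i: "1 \<le> i"
    and alpha: "\<And>n. n \<in> min_gens I - set ms \<Longrightarrow> i \<le> alpha ms n"
  shows "well_ordered_cover I (drop (i - 1) ms @ take (i - 1) ms)"
proof -
  let ?rot = "drop (i - 1) ms @ take (i - 1) ms"
  have set: "set ?rot = set ms"
    using set_append[of "take (i - 1) ms" "drop (i - 1) ms"] by auto
  have "distinct (take (i - 1) ms @ drop (i - 1) ms)"
    using wo unfolding append_take_drop_id by (simp add: well_ordered_cover_def)
  then have dist: "distinct ?rot" unfolding distinct_append by blast
  have "\<exists>j\<in>{1..length ?rot - 1}. divides_tail ?rot n j" if n: "n \<in> min_gens I - set ?rot" for n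
  proof
    let ?j = "alpha ms n"
    have n': "n \<in> min_gens I - set ms" using n unfolding set .
    note tail = alpha_divides_tail[OF wo n'] and ij = alpha[OF n']
    show "?j - i + 1 \<in> {1..length ?rot - 1}" using tail(2) ij i by auto
    have "?rot ! (?j - i) = ms ! (?j - 1)"
      using tail(2) ij i by (auto simp: nth_append)
    moreover have "drop (?j - i + 1) ?rot = drop ?j ms @ take (i - 1) ms"
      using tail(2) ij i by simp
    moreover have "ms ! (?j - 1) \<le> lcm_list (n # drop ?j ms @ take (i - 1) ms)"
      using tail(1) unfolding divides_tail_def
      by (rule order_trans) (rule lcm_list_mono, auto)
    ultimately show "divides_tail ?rot n (?j - i + 1)"
      unfolding divides_tail_def add_diff_cancel_right' by (simp only:)
  qed
  then show ?thesis
    using wo dist unfolding well_ordered_cover_def set by blast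
qed

lemma divides_tail_drop:
  assumes wo: "well_ordered_cover I ms" and n: "n \<in> min_gens I - set ms" and i: "i < alpha ms n"
  shows "\<exists>j\<in>{1..length (drop i ms) - 1}. divides_tail (drop i ms) n j"
proof
  let ?j = "alpha ms n"
  note tail = alpha_divides_tail[OF wo n]
  show "?j - i \<in> {1..length (drop i ms) - 1}" using tail(2) i by auto
  have "drop i ms ! (?j - i - 1) = ms ! (?j - 1)" "drop (?j - i) (drop i ms) = drop ?j ms"
    using tail(2) i by auto
  then show "divides_tail (drop i ms) n (?j - i)"
    using tail(1) by (simp add: divides_tail_def)
qed

text \<open>
Otherwise the element at position \<open>\<alpha>(n)\<close>, which divides the lcm of \<open>n\<close> and the elements after it, would
divide the lcm of the first \<open>i\<close> elements and those after it. This contradicts irredundancy because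
\<open>i < \<alpha>(n)\<close> keeps it out of the first \<open>i\<close>.
\<close>

lemma no_other_generator_divides_take:
  assumes wo: "well_ordered_cover I ms" and n: "n \<in> min_gens I - set ms" and i: "i < alpha ms n"
  shows "\<not> n \<le> lcm_list (take i ms)"
proof
  assume le: "n \<le> lcm_list (take i ms)"
  let ?j = "alpha ms n"
  note tail = alpha_divides_tail[OF wo n]
  have dist: "distinct ms" using wo by (simp add: well_ordered_cover_def)
  have irr: "irredundant ms"
    using wo by (auto simp: well_ordered_cover_def intro: minimal_cover_irredundant)
  have "ms ! (?j - 1) \<le> lcm_list (n # drop ?j ms)" using tail(1) by (simp add: divides_tail_def)
  also have "\<dots> \<le> lcm_list (take i ms @ drop ?j ms)"
    unfolding lcm_list_le_iff
  proof
    fix x assume "x \<in> set (n # drop ?j ms)"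
    then consider "x = n" | "x \<in> set (drop ?j ms)" by auto
    then show "x \<le> lcm_list (take i ms @ drop ?j ms)"
    proof cases
      case 1
      have "lcm_list (take i ms) \<le> lcm_list (take i ms @ drop ?j ms)"
        by (rule lcm_list_mono) auto
      with 1 le show ?thesis by (meson order_trans)
    qed (auto intro: le_lcm_list)
  qed
  finally have "ms ! (?j - 1) \<le> lcm_list (take i ms @ drop ?j ms)" .
  moreover have "set (take i ms @ drop ?j ms) \<subseteq> set ms - {ms ! (?j - 1)}"
  proof -
    have "set (take i ms) \<subseteq> set (take (?j - 1) ms)"
      using i by (intro set_take_subset_set_take) auto
    moreover have "ms = take (?j - 1) ms @ ms ! (?j - 1) # drop ?j ms"
      using id_take_nth_drop[of "?j - 1" ms] tail(2) i by simp
    then have "distinct (take (?j - 1) ms @ ms ! (?j - 1) # drop ?j ms)" using dist by simp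
    ultimately show ?thesis
      by (auto dest: in_set_takeD in_set_dropD)
  qed
  moreover have "ms ! (?j - 1) \<in> set ms" using tail(2) by (intro nth_mem) auto
  ultimately show False using irredundant_not_le[OF irr] by blast
qed

theorem proposition6p2:
  fixes I :: "('n::finite, 'k::field) poly_ring set"
    and ms ns :: "'n monomial list"
    and l :: nat
  assumes "squarefree_monomial_ideal I"
    and "distinct (ms @ ns)"
    and "min_gens I = set (ms @ ns)"
    and "length ns \<ge> 1"
    and "well_ordered_cover I ms"
    and "l = Min (alpha ms ` set ns)"
    and "l > 1"
  shows "(\<forall>i \<in> {2..l}. well_ordered_cover I (drop (i - 1) ms @ take (i - 1) ms)) \<and>
    (\<forall>i \<in> {1..l - 1}.
       max_shift I (length ms) \<le> max_shift I (length ms - i) + max_shift I i)"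
proof (intro conjI ballI)
  note wo = assms(5)
  have n_iff: "n \<in> min_gens I - set ms \<longleftrightarrow> n \<in> set ns" for n
    using assms(2,3) by auto
  have l_le: "l \<le> alpha ms n" if "n \<in> set ns" for n
    unfolding assms(6) using that by (intro Min_le) auto
  have l_len: "l < length ms"
  proof -
    obtain n where n: "n \<in> set ns" using assms(4) by (cases ns) auto
    show ?thesis using l_le[OF n] alpha_divides_tail(2)[OF wo] n n_iff le_less_trans by blast
  qed
  show "well_ordered_cover I (drop (i - 1) ms @ take (i - 1) ms)" if "i \<in> {2..l}" for i
  proof (rule well_ordered_cover_rotate[OF wo])
    show "1 \<le> i" using that by simp
    show "i \<le> alpha ms n" if "n \<in> min_gens I - set ms" for n
      using l_le[of n] \<open>i \<in> {2..l}\<close> that n_iff by auto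
  qed
  fix i assume i: "i \<in> {1..l - 1}"
  then have il: "i < l" by auto
  have cov: "is_cover I (set ms)" and dist: "distinct ms"
    using wo by (auto simp: well_ordered_cover_def is_minimal_cover_def)
  have irr: "irredundant ms"
    using wo by (auto simp: well_ordered_cover_def intro: minimal_cover_irredundant)
  obtain F :: "('n, 'k) free_cplx" where F: "minimal_graded_free_resolution I F"
    and shift: "\<And>i. max_shift I i = Max (bdeg F i ` basis F i)"
    using max_shift_resolution[OF assms(1)] assms(3) by (metis List.finite_set)
  have I: "I = monomial_ideal (set zs)" if "set zs = set (ms @ ns)" for zs
    using squarefree_monomial_ideal_min_gens(1)[OF assms(1)] assms(3) that by simp
  have res: "graded_free_resolution I F"
    using F by (simp add: minimal_graded_free_resolution_def)
  note fin = resolution_finite[OF res]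

  have degree: "\<exists>b\<in>basis F (length xs). bdeg F (length xs) b = mdegree (lcm_list xs)"
    if "set (xs @ ys) = set (ms @ ns)" "irredundant xs"
      "\<And>n. n \<in> set ys \<Longrightarrow> n \<le> lcm_list xs \<Longrightarrow> \<exists>j\<in>{1..length xs - 1}. divides_tail xs n j" for xs ys
    using lcm_degree_occurs_in_every_resolution[OF res[unfolded I[OF that(1)]] that(2,3)] .
  have split: "set ms = set (take i ms) \<union> set (drop i ms)"
    by (metis append_take_drop_id set_append)
  have disj: "set (take i ms) \<inter> set (drop i ms) = {}"
    using dist by (rule set_take_disj_set_drop_if_distinct) simp

  have "\<exists>b\<in>basis F (length (take i ms)). bdeg F (length (take i ms)) b = mdegree (lcm_list (take i ms))"
  proof (rule degree)
    show "set (take i ms @ drop i ms @ ns) = set (ms @ ns)" using split by (simp add: Un_assoc)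
    show "irredundant (take i ms)"
      using irr by (rule irredundant_sublist) (auto simp: dist split)
    fix n assume n: "n \<in> set (drop i ms @ ns)" and le: "n \<le> lcm_list (take i ms)"
    have False
    proof (cases "n \<in> set ns")
      case True
      then show False
        using no_other_generator_divides_take[OF wo, of n i] le n_iff l_le[of n] il by auto
    next
      case False
      with n have "n \<in> set (drop i ms)" by simp
      then show False
        using irredundant_not_le[OF irr, of n "take i ms"] le disj split by blast
    qed
    then show "\<exists>j\<in>{1..length (take i ms) - 1}. divides_tail (take i ms) n j" ..
  qed
  then have "mdegree (lcm_list (take i ms)) \<in> bdeg F i ` basis F i"
    using l_len il by (simp add: min_absorb2) (metis imageI)
  then have low1: "mdegree (lcm_list (take i ms)) \<le> max_shift I i"
    unfolding shift using fin by (intro Max_ge) auto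

  have "\<exists>b\<in>basis F (length (drop i ms)). bdeg F (length (drop i ms)) b = mdegree (lcm_list (drop i ms))"
  proof (rule degree)
    show "set (drop i ms @ take i ms @ ns) = set (ms @ ns)" using split by auto
    show "irredundant (drop i ms)"
      using irr by (rule irredundant_sublist) (auto simp: dist split)
    fix n assume n: "n \<in> set (take i ms @ ns)" and le: "n \<le> lcm_list (drop i ms)"
    have "n \<notin> set (take i ms)"
      using irredundant_not_le[OF irr, of n "drop i ms"] le disj split by blast
    with n have "n \<in> set ns" by simp
    then show "\<exists>j\<in>{1..length (drop i ms) - 1}. divides_tail (drop i ms) n j"
      using l_le[of n] il n_iff by (intro divides_tail_drop[OF wo]) auto
  qed
  then have "mdegree (lcm_list (drop i ms)) \<in> bdeg F (length ms - i) ` basis F (length ms - i)"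
    by simp (metis imageI)
  then have low2: "mdegree (lcm_list (drop i ms)) \<le> max_shift I (length ms - i)"
    unfolding shift using fin by (intro Max_ge) auto

  have "\<exists>b\<in>basis F (length ms). bdeg F (length ms) b = mdegree (lcm_list ms)"
    using degree[of ms ns] irr wo n_iff by (auto simp: well_ordered_cover_def)
  then have "bdeg F (length ms) ` basis F (length ms) \<noteq> {}" by blast
  then have "max_shift I (length ms) \<le> mdegree (lcm_list (ms @ ns))"
    unfolding shift using minimal_resolution_degree_le[OF F[unfolded I[OF refl]]] fin
    by (intro Max.boundedI) auto
  \<comment> \<open>Addition of exponent vectors is multiplication of monomials.\<close>
  also have "lcm_list (ms @ ns) \<le> lcm_list (drop i ms) + lcm_list (take i ms)"
    unfolding lcm_list_le_iff
  proof (intro ballI le_funI)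
    fix g v assume g: "g \<in> set (ms @ ns)"
    show "g v \<le> (lcm_list (drop i ms) + lcm_list (take i ms)) v"
    proof (cases "g v = 0")
      case False
      then obtain a where a: "a \<in> set ms" "0 < a v"
        using cov g assms(3) by (auto simp: is_cover_def)
      have "0 < lcm_list zs v" if "a \<in> set zs" for zs
        by (rule less_le_trans[OF a(2) le_funD[OF le_lcm_list[OF that]]])
      then have "0 < lcm_list (drop i ms) v + lcm_list (take i ms) v"
        using a(1) split by (metis UnE add_pos_nonneg add_nonneg_pos zero_le)
      moreover have "g v \<le> 1"
        using squarefree_monomial_ideal_min_gens(2)[OF assms(1)] g assms(3) by simp
      ultimately show ?thesis unfolding plus_fun_apply by linarith
    qed simp
  qed
  then have "mdegree (lcm_list (ms @ ns)) \<le> mdegree (lcm_list (drop i ms)) + mdegree (lcm_list (take i ms))"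
    unfolding mdegree_add[symmetric] by (rule mdegree_mono)
  finally show "max_shift I (length ms) \<le> max_shift I (length ms - i) + max_shift I i"
    using low1 low2 by simp
qed

end
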